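(* For every integer $c\geq 2$ let $M_c=\langle x_0,x_1,\ldots,x_c\mid [x_0,x_i]=x_{i+1}\text{ for all }1\leq i\leq c-1\rangle$. Then for every prime $p$, $$\zeta_{M_2(\mathbb{F}_p)}^{\leq}(s)=1+(1+p)t+(1+p+p^2)t^2+t^3,$$ and for every $c\geq3$, $$\zeta_{M_c(\mathbb{F}_p)}^{\leq}(s)=\zeta_{M_{c-1}(\mathbb{F}_p)}^{\leq}(s)+\sum_{a=0}^{c-1}\binom{c-1}{a}_p\,p^{c-1-a}\,t^{a+2}+p^c t^c.$$
   Context: A presentation of a Lie ring lists a $\mathbb{Z}$-module basis together with brackets of basis elements; all brackets not listed are zero, up to antisymmetry. For a Lie ring $L\cong\mathbb{Z}^n$ (additively) and a prime $p$, $L(\mathbb{F}_p)=L\otimes_{\mathbb{Z}}\mathbb{F}_p$, and $\zeta_{L(\mathbb{F}_p)}^{\leq}(s)=\sum_{i=0}^{n}a_{p^i}^{\leq}(L(\mathbb{F}_p))\,t^{i}$, where $t=p^{-s}$ and $a_{p^i}^{\leq}(L(\mathbb{F}_p))$ is the number of $\mathbb{F}_p$-Lie subalgebras of $L(\mathbb{F}_p)$ of codimension $i$. $\binom{m}{a}_p$ denotes the Gaussian binomial coefficient, the number of $a$-dimensional subspaces of $\mathbb{F}_p^m$. *)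

theory Defs
  imports
    "HOL-Analysis.Complex_Transcendental"
    "HOL-Algebra.Free_Abelian_Groups"
    "HOL-Algebra.IntRing"
    "HOL-Number_Theory.Residues"
    "Jordan_Normal_Form.Missing_VectorSpace"
begin

section \<open>Lie rings and Lie algebras\<close>

text \<open>
  Lie algebras over a commutative ring reuse the module records of HOL-Algebra; the fields
  \<open>mult\<close> and \<open>one\<close> that these records inherit from rings carry no information.
  A Lie ring is a Lie algebra over \<open>\<Z>\<close>.
\<close>

record ('r, 'a) lie = "('r, 'a) module" +
  bracket :: "'a \<Rightarrow> 'a \<Rightarrow> 'a"

locale lie_algebra = module R L for R (structure) and L :: "('r, 'a, 'm) lie_scheme" (structure) +
  assumes bracket_closed:
      "\<lbrakk>x \<in> carrier L; y \<in> carrier L\<rbrakk> \<Longrightarrow> bracket L x y \<in> carrier L"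
    and bracket_add_left:
      "\<lbrakk>x \<in> carrier L; y \<in> carrier L; z \<in> carrier L\<rbrakk> \<Longrightarrow>
        bracket L (x \<oplus>\<^bsub>L\<^esub> y) z = bracket L x z \<oplus>\<^bsub>L\<^esub> bracket L y z"
    and bracket_add_right:
      "\<lbrakk>x \<in> carrier L; y \<in> carrier L; z \<in> carrier L\<rbrakk> \<Longrightarrow>
        bracket L x (y \<oplus>\<^bsub>L\<^esub> z) = bracket L x y \<oplus>\<^bsub>L\<^esub> bracket L x z"
    and bracket_smult_left:
      "\<lbrakk>a \<in> carrier R; x \<in> carrier L; y \<in> carrier L\<rbrakk> \<Longrightarrow>
        bracket L (a \<odot>\<^bsub>L\<^esub> x) y = a \<odot>\<^bsub>L\<^esub> bracket L x y"
    and bracket_smult_right: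
      "\<lbrakk>a \<in> carrier R; x \<in> carrier L; y \<in> carrier L\<rbrakk> \<Longrightarrow>
        bracket L x (a \<odot>\<^bsub>L\<^esub> y) = a \<odot>\<^bsub>L\<^esub> bracket L x y"
    and bracket_self: "x \<in> carrier L \<Longrightarrow> bracket L x x = \<zero>\<^bsub>L\<^esub>"
    and jacobi:
      "\<lbrakk>x \<in> carrier L; y \<in> carrier L; z \<in> carrier L\<rbrakk> \<Longrightarrow>
        bracket L x (bracket L y z) \<oplus>\<^bsub>L\<^esub> bracket L y (bracket L z x)
          \<oplus>\<^bsub>L\<^esub> bracket L z (bracket L x y) = \<zero>\<^bsub>L\<^esub>"

definition lie_subalgebra :: "('r, 'n) ring_scheme \<Rightarrow> 'a set \<Rightarrow> ('r, 'a, 'm) lie_scheme \<Rightarrow> bool"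
  where "lie_subalgebra K H L \<longleftrightarrow>
    VectorSpace.subspace K H L \<and> (\<forall>x\<in>H. \<forall>y\<in>H. bracket L x y \<in> H)"


section \<open>Presentations\<close>

text \<open>
  A presentation consists of a set \<open>I\<close> indexing a \<open>\<Z>\<close>-basis and a partial map \<open>B\<close> listing
  brackets: \<open>B (i, j) = Some v\<close> stands for \<open>[x\<^sub>i, x\<^sub>j] = v\<close>.  The presented Lie ring is the free
  abelian group on \<open>I\<close>, whose basis element \<open>x\<^sub>i\<close> is \<^term>\<open>frag_of i\<close>, with the \<open>\<Z>\<close>-bilinear
  bracket determined by \<open>B\<close>.
\<close>

definition basis_bracket :: "('i \<times> 'i \<Rightarrow> ('i \<Rightarrow>\<^sub>0 int) option) \<Rightarrow> 'i \<Rightarrow> 'i \<Rightarrow> 'i \<Rightarrow>\<^sub>0 int"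
  where "basis_bracket B i j =
    (case B (i, j) of Some v \<Rightarrow> v
     | None \<Rightarrow> (case B (j, i) of Some v \<Rightarrow> - v | None \<Rightarrow> 0))"

definition presented_lie_ring ::
    "'i set \<Rightarrow> ('i \<times> 'i \<Rightarrow> ('i \<Rightarrow>\<^sub>0 int) option) \<Rightarrow> (int, 'i \<Rightarrow>\<^sub>0 int) lie"
  where "presented_lie_ring I B =
    \<lparr>carrier = carrier (free_Abelian_group I),
     monoid.mult = undefined,
     one = undefined,
     zero = 0,
     add = (+),
     smult = frag_cmul,
     bracket = (\<lambda>f g. frag_extend (\<lambda>i. frag_extend (\<lambda>j. basis_bracket B i j) g) f)\<rparr>"

definition M :: "nat \<Rightarrow> (int, nat \<Rightarrow>\<^sub>0 int) lie"
  where "M c = presented_lie_ring {0..c}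
    (\<lambda>(i, j). if i = 0 \<and> 1 \<le> j \<and> j \<le> c - 1 then Some (frag_of (j + 1)) else None)"

definition lie_ring_rank :: "(int, 'a, 'm) lie_scheme \<Rightarrow> nat"
  where "lie_ring_rank L = (THE n. add_monoid L \<cong> free_Abelian_group {..<n})"


section \<open>Extension of scalars\<close>

text \<open>
  The abelian group \<open>L \<otimes>\<^sub>\<Z> R\<close> is the free abelian group on pairs \<open>(x, a)\<close>, standing for
  \<open>x \<otimes> a\<close>, modulo the subgroup generated by the usual relators.  Its elements are cosets.  Scalar
  multiplication \<open>r (x \<otimes> a) = x \<otimes> r a\<close> and bracket \<open>[x \<otimes> a, y \<otimes> b] = [x, y] \<otimes> a b\<close> are extended
  additively to representatives; the unions are over equal cosets, as in \<^const>\<open>rcoset_mult\<close>.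
\<close>

definition tensor_relators ::
    "(int, 'a, 'm) module_scheme \<Rightarrow> ('r, 'n) ring_scheme \<Rightarrow> ('a \<times> 'r \<Rightarrow>\<^sub>0 int) set"
  where "tensor_relators L R =
    {frag_of (x \<oplus>\<^bsub>L\<^esub> y, a) - frag_of (x, a) - frag_of (y, a) | x y a.
       x \<in> carrier L \<and> y \<in> carrier L \<and> a \<in> carrier R} \<union>
    {frag_of (x, a \<oplus>\<^bsub>R\<^esub> b) - frag_of (x, a) - frag_of (x, b) | x a b.
       x \<in> carrier L \<and> a \<in> carrier R \<and> b \<in> carrier R} \<union>
    {frag_of (n \<odot>\<^bsub>L\<^esub> x, a) - frag_of (x, [n] \<cdot>\<^bsub>R\<^esub> a) | n x a.
       x \<in> carrier L \<and> a \<in> carrier R}"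

definition extend_scalars ::
    "(int, 'a, 'm) lie_scheme \<Rightarrow> ('r, 'n) ring_scheme \<Rightarrow> ('r, ('a \<times> 'r \<Rightarrow>\<^sub>0 int) set) lie"
  where "extend_scalars L R =
    (let F = free_Abelian_group (carrier L \<times> carrier R);
         N = generate F (tensor_relators L R)
     in \<lparr>carrier = carrier (F Mod N),
         monoid.mult = undefined,
         one = undefined,
         zero = \<one>\<^bsub>F Mod N\<^esub>,
         add = (\<lambda>X Y. X \<otimes>\<^bsub>F Mod N\<^esub> Y),
         smult = (\<lambda>r X. \<Union>f\<in>X.
           N #>\<^bsub>F\<^esub> frag_extend (\<lambda>(x, a). frag_of (x, r \<otimes>\<^bsub>R\<^esub> a)) f),
         bracket = (\<lambda>X Y. \<Union>f\<in>X. \<Union>g\<in>Y.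
           N #>\<^bsub>F\<^esub> frag_extend (\<lambda>(x, a).
             frag_extend (\<lambda>(y, b). frag_of (bracket L x y, a \<otimes>\<^bsub>R\<^esub> b)) g) f)\<rparr>)"


section \<open>Subalgebra zeta functions and Gaussian binomial coefficients\<close>

abbreviation GFp :: "nat \<Rightarrow> int ring"
  where "GFp p \<equiv> residue_ring (int p)"

text \<open>Number of subalgebras of codimension \<open>i\<close>, i.e. of index \<open>p ^ i\<close>, in \<open>L(\<F>\<^sub>p)\<close>.\<close>

definition num_subalgebras :: "nat \<Rightarrow> (int, 'a, 'm) lie_scheme \<Rightarrow> nat \<Rightarrow> nat"
  where "num_subalgebras p L i =
    (let K = GFp p; V = extend_scalars L K
     in card {H. lie_subalgebra K H V \<and>
                 vectorspace.dim K (V\<lparr>carrier := H\<rparr>) + i = vectorspace.dim K V})"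

definition subalgebra_zeta :: "nat \<Rightarrow> (int, 'a, 'm) lie_scheme \<Rightarrow> complex \<Rightarrow> complex"
  where "subalgebra_zeta p L s =
    (\<Sum>i = 0..lie_ring_rank L. of_nat (num_subalgebras p L i) * ((of_nat p :: complex) powr (- s)) ^ i)"

definition gauss_binomial :: "nat \<Rightarrow> nat \<Rightarrow> nat \<Rightarrow> nat"
  where "gauss_binomial p m a =
    (let K = GFp p; V = ring.func_space K {..<m}
     in card {W. VectorSpace.subspace K W V \<and> vectorspace.dim K (V\<lparr>carrier := W\<rparr>) = a})"


section \<open>Consistency checks\<close>

lemma basis_bracket_M:
  fixes c i j :: nat
  shows "basis_bracket
      (\<lambda>(i, j). if i = 0 \<and> 1 \<le> j \<and> j \<le> c - 1 then Some (frag_of (j + 1)) else None) i j =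
    (if i = 0 \<and> 1 \<le> j \<and> j \<le> c - 1 then frag_of (j + 1)
     else if j = 0 \<and> 1 \<le> i \<and> i \<le> c - 1 then - frag_of (i + 1) else 0)"
  by (auto simp: basis_bracket_def)

lemma frag_extend_fun_add:
  "frag_extend (\<lambda>i. u i + v i) f = frag_extend u f + frag_extend v f"
  by (simp add: frag_extend_def frag_cmul_distrib2 sum.distrib)

lemma frag_extend_fun_cmul:
  "frag_extend (\<lambda>i. frag_cmul a (u i)) f = frag_cmul a (frag_extend u f)"
  by (simp add: frag_extend_def frag_cmul_sum mult.commute)

lemma lie_ring_M: "lie_algebra \<Z> (M c)"
proof -
  define b where "b = (\<lambda>i j :: nat.
    if i = 0 \<and> 1 \<le> j \<and> j \<le> c - 1 then frag_of (j + 1)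
    else if j = 0 \<and> 1 \<le> i \<and> i \<le> c - 1 then - frag_of (i + 1) else 0)"
  define B where "B = (\<lambda>f g. frag_extend (\<lambda>i. frag_extend (b i) g) f)"
  have L: "carrier (M c) = {f. Poly_Mapping.keys f \<subseteq> {0..c}}" "zero (M c) = 0"
    "add (M c) = (+)" "smult (M c) = frag_cmul" "bracket (M c) = B"
    unfolding M_def presented_lie_ring_def B_def b_def basis_bracket_M
    by (simp_all add: free_Abelian_group_def)
  have addl: "B (f + g) h = B f h + B g h" and addr: "B f (g + h) = B f g + B f h"
    and cl: "B (frag_cmul a f) g = frag_cmul a (B f g)"
    and cr: "B f (frag_cmul a g) = frag_cmul a (B f g)" for f g h a
    by (simp_all add: B_def frag_extend_add frag_extend_fun_add frag_extend_cmul
        frag_extend_fun_cmul)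
  have zl: "B 0 f = 0" and zr: "B f 0 = 0" for f
    using cl [of 0 0 f] cr [of f 0 0] by simp_all
  have ml: "B (- f) g = - B f g" and mr: "B f (- g) = - B f g" for f g
    using cl [of "-1" f g] cr [of f "-1" g] by simp_all
  have dl: "B (f - g) h = B f h - B g h" and dr: "B f (g - h) = B f g - B f h" for f g h
    using addl [of f "- g" h] addr [of f g "- h"] by (simp_all add: ml mr)
  have of_of: "B (frag_of i) (frag_of j) = b i j" for i j
    by (simp add: B_def)
  note lin = zl zr ml mr dl dr of_of
  have anti: "B f g = - B g f" for f g
  proof -
    have *: "B (frag_of i) g = - B g (frag_of i)" for i g
      by (rule frag_induction [of g UNIV]) (auto simp: lin b_def)
    show ?thesis
      by (rule frag_induction [of f UNIV]) (auto simp: lin *)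
  qed
  have self: "B f f = 0" for f
  proof -
    have eq: "B f f = - B f f" by (rule anti)
    have "Poly_Mapping.lookup (B f f) k = 0" for k
      using arg_cong [OF eq, of "\<lambda>u. Poly_Mapping.lookup u k"] by simp
    then show ?thesis by (intro poly_mapping_eqI) simp
  qed
  have jac: "B f (B g h) + B g (B h f) + B h (B f g) = 0" for f g h
  proof -
    note single_one [simp del]
    have 1: "B (frag_of i) (B (frag_of j) (frag_of k)) + B (frag_of j) (B (frag_of k) (frag_of i))
        + B (frag_of k) (B (frag_of i) (frag_of j)) = 0" for i j k
      by (auto simp: lin b_def)
    define J where "J = (\<lambda>f g h. B f (B g h) + B g (B h f) + B h (B f g))"
    have J: "J (u - v) g h = J u g h - J v g h" "J f (u - v) h = J f u h - J f v h"
        "J f g (u - v) = J f g u - J f g v" "J 0 g h = 0" "J f 0 h = 0" "J f g 0 = 0" for u v f g h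
      by (simp_all add: J_def zl zr dl dr)
    have J1: "J (frag_of i) (frag_of j) (frag_of k) = 0" for i j k
      using 1 by (simp add: J_def)
    have J2: "J (frag_of i) (frag_of j) h = 0" for i j h
      by (rule frag_induction [of h UNIV]) (simp_all add: J J1)
    have J3: "J (frag_of i) g h = 0" for i g h
      by (rule frag_induction [of g UNIV]) (simp_all add: J J2)
    have "J f g h = 0"
      by (rule frag_induction [of f UNIV]) (simp_all add: J J3)
    then show ?thesis by (simp add: J_def)
  qed
  have keys: "Poly_Mapping.keys (B f g) \<subseteq> {0..c}" for f g
  proof -
    have b: "Poly_Mapping.keys (b i j) \<subseteq> {0..c}" for i j
      by (auto simp: b_def)
    have "Poly_Mapping.keys (frag_extend (b i) g) \<subseteq> {0..c}" for i
      using keys_frag_extend [of "b i" g] b by blast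
    then show ?thesis
      unfolding B_def using keys_frag_extend [of "\<lambda>i. frag_extend (b i) g" f] by blast
  qed
  have grp: "abelian_group (M c)"
  proof (rule abelian_groupI)
    fix x assume "x \<in> carrier (M c)"
    then show "\<exists>y\<in>carrier (M c). y \<oplus>\<^bsub>M c\<^esub> x = \<zero>\<^bsub>M c\<^esub>"
      by (intro bexI [of _ "- x"]) (simp_all add: L)
  qed (use keys_add in \<open>fastforce simp: L ac_simps\<close>)+
  have "module \<Z> (M c)"
    by (rule moduleI [OF int_is_cring grp])
      (use keys_cmul in \<open>fastforce simp: L frag_cmul_distrib frag_cmul_distrib2\<close>)+
  then show ?thesis
    by (intro lie_algebra.intro lie_algebra_axioms.intro)
      (simp_all add: L keys addl addr cl cr self jac)
qed

lemma lie_ring_rank_M: "lie_ring_rank (M c) = c + 1"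
proof -
  have "{..<c + 1} = {0..c}" by auto
  then have "add_monoid (M c) \<cong> free_Abelian_group {..<n} \<longleftrightarrow>
      free_Abelian_group {..<c + 1} \<cong> free_Abelian_group {..<n}" for n :: nat
    by (simp add: M_def presented_lie_ring_def free_Abelian_group_def is_iso_def iso_def hom_def)
  then have "add_monoid (M c) \<cong> free_Abelian_group {..<n} \<longleftrightarrow> n = c + 1" for n :: nat
    unfolding isomorphic_free_Abelian_groups by (auto simp: eqpoll_iff_card)
  then show ?thesis
    unfolding lie_ring_rank_def by (intro the_equality) blast+
qed

end

theory Submission
  imports Defs
begin

text \<open>
  Write \<open>L = M\<^sub>c(\<F>\<^sub>p)\<close> and let \<open>A = \<langle>x\<^sub>1, \<dots>, x\<^sub>c\<rangle>\<close>, an abelian ideal of codimension one on which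
  \<open>x\<^sub>0\<close> acts as a single nilpotent Jordan block.  Every subspace of \<open>A\<close> is a subalgebra.  A subspace
  \<open>H\<close> not contained in \<open>A\<close> is a subalgebra iff \<open>H \<inter> A\<close> is invariant under \<open>x\<^sub>0\<close>; a Jordan block
  has exactly one invariant subspace of each dimension \<open>d \<le> c\<close>, and \<open>p\<^bsup>c - d\<^esup>\<close> subspaces
  \<open>H\<close> meet \<open>A\<close> in it.  Hence the zeta function is
  \<open>(\<Sum>i\<le>c. binom(c, i)\<^sub>p t\<^bsup>i + 1\<^esup>) + (\<Sum>i\<le>c. p\<^sup>i t\<^sup>i)\<close>, and the recursion is the \<open>q\<close>-Pascal
  rule, which comes from the same count of the subspaces meeting a hyperplane in a given subspace.

  Over \<open>\<F>\<^sub>p\<close> a subspace has dimension \<open>k\<close> iff it has \<open>p\<^sup>k\<close> elements, so the counting can be done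
  with plain sets of integer vectors reduced modulo \<open>p\<close>.
\<close>

section \<open>Subspaces of coordinate space\<close>

locale prime_modulus =
  fixes p :: nat
  assumes prime_p: "prime p"
begin

text \<open>\<open>mod_simps\<close> removes a reduction that stands directly under a sum or a
  product; these rules reach one inside a product that is itself a summand.\<close>

lemma mod_lin:
  fixes a b m x y :: int
  shows "(a * (x mod m) + y) mod m = (a * x + y) mod m"
    and "((x mod m) * a + y) mod m = (x * a + y) mod m"
    and "(y + a * (x mod m)) mod m = (y + a * x) mod m"
    and "(y + (x mod m) * a) mod m = (y + x * a) mod m"
    and "(a * (x mod m) - y) mod m = (a * x - y) mod m"
    and "((x mod m) * a - y) mod m = (x * a - y) mod m"
    and "(y - a * (x mod m)) mod m = (y - a * x) mod m"
    and "(y - (x mod m) * a) mod m = (y - x * a) mod m"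
  by (metis mod_add_left_eq mod_mult_right_eq, metis mod_add_left_eq mod_mult_left_eq,
      metis mod_add_right_eq mod_mult_right_eq, metis mod_add_right_eq mod_mult_left_eq,
      metis mod_diff_left_eq mod_mult_right_eq, metis mod_diff_left_eq mod_mult_left_eq,
      metis mod_diff_right_eq mod_mult_right_eq, metis mod_diff_right_eq mod_mult_left_eq)

text \<open>Entries are canonical residues, so equality in F_p^n is equality of functions. Padding
  with zeros makes \<open>vecs n\<close> literally a hyperplane of
  \<open>vecs (Suc n)\<close>.\<close>

definition vecs :: "nat \<Rightarrow> (nat \<Rightarrow> int) set" where
  "vecs n = {f. (\<forall>i<n. 0 \<le> f i \<and> f i < int p) \<and> (\<forall>i\<ge>n. f i = 0)}"

text \<open>The coefficients are arbitrary integers, which gives differences without a separate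
  negation; \<open>b = 0\<close> gives scaling.\<close>

definition lc :: "int \<Rightarrow> (nat \<Rightarrow> int) \<Rightarrow> int \<Rightarrow> (nat \<Rightarrow> int) \<Rightarrow> nat \<Rightarrow> int" where
  "lc a f b g = (\<lambda>i. (a * f i + b * g i) mod int p)"

definition lin :: "(nat \<Rightarrow> int) set \<Rightarrow> bool" where
  "lin H \<longleftrightarrow> (\<lambda>_. 0) \<in> H \<and> (\<forall>f\<in>H. \<forall>g\<in>H. \<forall>a b. lc a f b g \<in> H)"

lemma p_gt_1: "int p > 1" and p_pos: "int p > 0"
  using prime_gt_1_nat [OF prime_p] by auto

lemma linD: "lin H \<Longrightarrow> f \<in> H \<Longrightarrow> g \<in> H \<Longrightarrow> lc a f b g \<in> H"
  by (simp add: lin_def)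

lemma lin_0: "lin H \<Longrightarrow> (\<lambda>_. 0) \<in> H"
  by (simp add: lin_def)

lemma lin_Int: "lin H \<Longrightarrow> lin H' \<Longrightarrow> lin (H \<inter> H')"
  by (simp add: lin_def)

lemma lin_vecs: "lin (vecs n)"
  using p_pos by (simp add: lin_def vecs_def lc_def)

lemma vecs_mod: "f \<in> vecs n \<Longrightarrow> f i mod int p = f i"
  by (cases "i < n") (simp_all add: vecs_def)

lemma vecs_outside: "f \<in> vecs n \<Longrightarrow> i \<ge> n \<Longrightarrow> f i = 0"
  by (simp add: vecs_def)

lemma vecs_Suc_iff: "f \<in> vecs n \<longleftrightarrow> f \<in> vecs (Suc n) \<and> f n = 0"
proof -
  have "(\<forall>i\<ge>n. f i = 0) \<longleftrightarrow> (\<forall>i\<ge>Suc n. f i = 0) \<and> f n = 0"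
    by (metis Suc_leD le_refl not_less_eq_eq antisym)
  then show ?thesis
    using p_pos by (auto simp: vecs_def less_Suc_eq)
qed

lemma vecs_mono: "m \<le> n \<Longrightarrow> vecs m \<subseteq> vecs n"
  by (induction rule: dec_induct) (use vecs_Suc_iff in blast)+

lemma vecs_0: "vecs 0 = {\<lambda>_. 0}"
  by (auto simp: vecs_def)

lemma upd_vecs: "v \<in> vecs n \<Longrightarrow> v(n := 1) \<in> vecs (Suc n)"
  using p_gt_1 by (simp add: vecs_def less_Suc_eq)

lemma upd_vecs': "w \<in> vecs (Suc n) \<Longrightarrow> w(n := 0) \<in> vecs n"
  by (simp add: vecs_def less_Suc_eq)

text \<open>A nonzero last coordinate is invertible modulo the prime \<open>p\<close>, so a vector
  outside the hyperplane can be rescaled.\<close>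

lemma lin_normalise:
  assumes "lin H" "H \<subseteq> vecs (Suc n)" "\<not> H \<subseteq> vecs n"
  obtains w where "w \<in> H" "w n = 1"
proof -
  obtain w where w: "w \<in> H" "w n \<noteq> 0"
    using assms vecs_Suc_iff by blast
  then have "0 < w n" "w n < int p"
    using assms(2) by (auto simp: vecs_def subset_iff less_Suc_eq order_less_le)
  then have "coprime (w n) (int p)"
    using prime_p by (metis coprime_commute prime_imp_coprime prime_nat_int_transfer zdvd_not_zless)
  then obtain u where "[w n * u = 1] (mod int p)"
    using cong_solve_coprime_int by blast
  then have "lc u w 0 w n = 1"
    using p_gt_1 by (simp add: lc_def cong_def mult.commute)
  then show thesis
    using that linD [OF assms(1) w(1) w(1)] by blast
qed

text \<open>\<open>H\<close> is the direct sum of the line through a normalised vector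
  \<open>w\<close> and its section by the hyperplane, and a line has \<open>p\<close>
  points.\<close>

lemma card_hyperplane_section:
  assumes H: "lin H" "H \<subseteq> vecs (Suc n)" "\<not> H \<subseteq> vecs n"
  shows "card H = p * card (H \<inter> vecs n)"
proof -
  obtain w where w: "w \<in> H" "w n = 1"
    using lin_normalise H by blast
  have "bij_betw (\<lambda>(k, u). lc k w 1 u) ({0..<int p} \<times> (H \<inter> vecs n)) H"
  \<comment> \<open>The inverse reads the coefficient of \<open>w\<close> off coordinate
    \<open>n\<close> and subtracts that multiple of \<open>w\<close>.\<close>
  proof (rule bij_betw_byWitness [where f' = "\<lambda>g. (g n, lc 1 g (- g n) w)"])
    show "\<forall>x\<in>{0..<int p} \<times> (H \<inter> vecs n).
        (\<lambda>g. (g n, lc 1 g (- g n) w)) ((\<lambda>(k, u). lc k w 1 u) x) = x"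
    proof
      fix x assume "x \<in> {0..<int p} \<times> (H \<inter> vecs n)"
      then obtain k u where x: "x = (k, u)" and k: "0 \<le> k" "k < int p"
          and u: "u \<in> H" "u \<in> vecs n"
        by auto
      have "lc k w 1 u n = k"
        using k vecs_outside [OF u(2), of n] w by (simp add: lc_def)
      moreover have "lc 1 (lc k w 1 u) (- k) w = u"
        using vecs_mod [OF u(2)] by (simp add: lc_def mod_simps)
      ultimately show "(\<lambda>g. (g n, lc 1 g (- g n) w)) ((\<lambda>(k, u). lc k w 1 u) x) = x"
        by (simp add: x)
    qed
    show "\<forall>g\<in>H. (\<lambda>(k, u). lc k w 1 u) (g n, lc 1 g (- g n) w) = g"
      using H(2) vecs_mod by (fastforce simp: lc_def mod_simps)
    show "(\<lambda>(k, u). lc k w 1 u) ` ({0..<int p} \<times> (H \<inter> vecs n)) \<subseteq> H"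
      using linD [OF H(1)] w by auto
    show "(\<lambda>g. (g n, lc 1 g (- g n) w)) ` H \<subseteq> {0..<int p} \<times> (H \<inter> vecs n)"
    proof (rule image_subsetI)
      fix g assume g: "g \<in> H"
      then have "g \<in> vecs (Suc n)"
        using H by blast
      then have "0 \<le> g n" "g n < int p"
        by (auto simp: vecs_def)
      moreover have l: "lc 1 g (- g n) w \<in> H"
        using linD [OF H(1)] w g by auto
      moreover have "lc 1 g (- g n) w n = 0"
        by (simp add: lc_def w)
      ultimately show "(g n, lc 1 g (- g n) w) \<in> {0..<int p} \<times> (H \<inter> vecs n)"
        using H(2) vecs_Suc_iff [of _ n] by auto
    qed
  qed
  from bij_betw_same_card [OF this] show ?thesis
    by (simp add: card_cartesian_product)
qed

lemma card_vecs: "card (vecs n) = p ^ n"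
proof (induction n)
  case (Suc n)
  \<comment> \<open>The last unit vector shows that the full space is not contained in its
    hyperplane.\<close>
  have "(\<lambda>_. 0)(n := 1) \<in> vecs (Suc n) - vecs n"
    using upd_vecs lin_0 [OF lin_vecs] vecs_outside by fastforce
  moreover have "vecs (Suc n) \<inter> vecs n = vecs n"
    using vecs_mono [of n "Suc n"] by auto
  ultimately show ?case
    using card_hyperplane_section [OF lin_vecs, of "Suc n" n] Suc by auto
qed (simp add: vecs_0)

lemma finite_vecs: "finite (vecs n)"
  using card_vecs [of n] p_pos card.infinite by fastforce

lemma finite_subsets_vecs: "finite {H. H \<subseteq> vecs n \<and> P H}"
  by (rule finite_subset [of _ "Pow (vecs n)"]) (auto simp: finite_vecs)

section \<open>Extensions of a subspace of the hyperplane\<close>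

definition extensions :: "nat \<Rightarrow> (nat \<Rightarrow> int) set \<Rightarrow> (nat \<Rightarrow> int) set set" where
  "extensions n U = {H. H \<subseteq> vecs (Suc n) \<and> lin H \<and> H \<inter> vecs n = U \<and> \<not> H \<subseteq> vecs n}"

text \<open>The vectors of \<open>H\<close> with last coordinate 1 form a coset of \<open>U\<close>:
  subtracting a fixed one, \<open>w\<close>, identifies them with \<open>U\<close>.\<close>

lemma extension_section:
  assumes H: "H \<in> extensions n U"
  shows "card {v \<in> vecs n. v(n := 1) \<in> H} = card U"
proof -
  have H': "H \<subseteq> vecs (Suc n)" "lin H" "H \<inter> vecs n = U" "\<not> H \<subseteq> vecs n"
    using H by (auto simp: extensions_def)
  obtain w where w: "w \<in> H" "w n = 1"
    using lin_normalise H' by blast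
  \<comment> \<open>Clearing coordinate \<open>n\<close> records a vector of the coset inside
    \<open>vecs n\<close>; the inverse restores the entry 1 first.\<close>
  have "bij_betw (\<lambda>u. (lc 1 w 1 u)(n := 0)) U {v \<in> vecs n. v(n := 1) \<in> H}"
  proof (rule bij_betw_byWitness [where f' = "\<lambda>v. lc 1 (v(n := 1)) (- 1) w"])
    show "\<forall>u\<in>U. lc 1 ((lc 1 w 1 u)(n := 0, n := 1)) (- 1) w = u"
    proof
      fix u assume "u \<in> U"
      then have u: "u \<in> vecs n" using H' by auto
      have "lc 1 w 1 u n = 1"
        using p_gt_1 vecs_outside [OF u, of n] w by (simp add: lc_def)
      then have "(lc 1 w 1 u)(n := 1) = lc 1 w 1 u"
        by auto
      then show "lc 1 ((lc 1 w 1 u)(n := 0, n := 1)) (- 1) w = u"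
        using vecs_mod [OF u] by (simp add: lc_def mod_simps)
    qed
    show "\<forall>v\<in>{v \<in> vecs n. v(n := 1) \<in> H}. (lc 1 w 1 (lc 1 (v(n := 1)) (- 1) w))(n := 0) = v"
      using vecs_outside vecs_mod by (fastforce simp: lc_def mod_simps)
    show "(\<lambda>u. (lc 1 w 1 u)(n := 0)) ` U \<subseteq> {v \<in> vecs n. v(n := 1) \<in> H}"
    proof clarsimp
      fix u assume "u \<in> U"
      then have u: "u \<in> vecs n" "u \<in> H" using H' by auto
      have "lc 1 w 1 u n = 1"
        using p_gt_1 vecs_outside [OF u(1), of n] w by (simp add: lc_def)
      then have "(lc 1 w 1 u)(n := 1) = lc 1 w 1 u"
        by auto
      then show "(lc 1 w 1 u)(n := 0) \<in> vecs n \<and> (lc 1 w 1 u)(n := 1) \<in> H"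
        using linD [OF H'(2) w(1) u(2), of 1 1] H'(1) upd_vecs' [of "lc 1 w 1 u" n] by auto
    qed
    show "(\<lambda>v. lc 1 (v(n := 1)) (- 1) w) ` {v \<in> vecs n. v(n := 1) \<in> H} \<subseteq> U"
    proof clarsimp
      fix v assume v: "v \<in> vecs n" "v(n := 1) \<in> H"
      have "lc 1 (v(n := 1)) (- 1) w \<in> H"
        by (rule linD [OF H'(2) v(2) w(1)])
      moreover have "lc 1 (v(n := 1)) (- 1) w n = 0"
        by (simp add: lc_def w)
      ultimately show "lc 1 (v(n := 1)) (- 1) w \<in> U"
        using H' vecs_Suc_iff [of _ n] by auto
    qed
  qed
  from bij_betw_same_card [OF this] show ?thesis
    by simp
qed

text \<open>Double counting: each of the \<open>p ^ n\<close> vectors of \<open>vecs n\<close>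
  selects one extension, and by \<open>extension_section\<close> each extension is selected
  \<open>card U\<close> times.\<close>

lemma card_extensions:
  assumes U: "U \<subseteq> vecs n" "lin U"
  shows "card (extensions n U) * card U = p ^ n"
proof -
  \<comment> \<open>With \<open>e\<close> the last unit vector, \<open>h v\<close> is the unique extension of \<open>U\<close> that contains \<open>e + v\<close>.\<close>
  define h where "h v = {g \<in> vecs (Suc n). lc 1 g (- g n) (v(n := 1)) \<in> U}" for v
  have h: "h v \<in> extensions n U" if v: "v \<in> vecs n" for v
  proof -
    have "lin (h v)"
      unfolding lin_def
    proof (intro conjI ballI allI)
      show "(\<lambda>_. 0) \<in> h v"
        using lin_0 [OF U(2)] lin_0 [OF lin_vecs] by (simp add: h_def lc_def)
      fix f g a b assume f: "f \<in> h v" and g: "g \<in> h v"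
      \<comment> \<open>Projection to the hyperplane along \<open>v(n := 1)\<close> is linear, so
        \<open>h v\<close>, the preimage of \<open>U\<close>, is a subspace.\<close>
      have "lc 1 (lc a f b g) (- lc a f b g n) (v(n := 1)) =
          lc a (lc 1 f (- f n) (v(n := 1))) b (lc 1 g (- g n) (v(n := 1)))"
        by (rule ext) (simp add: lc_def mod_simps mod_lin, simp add: algebra_simps)
      with f g show "lc a f b g \<in> h v"
        using linD [OF U(2)] linD [OF lin_vecs] by (simp add: h_def)
    qed
    moreover have "h v \<inter> vecs n = U"
    proof -
      have "lc 1 g (- g n) (v(n := 1)) = g" if "g \<in> vecs n" for g
        using that vecs_mod [OF that] vecs_outside [OF that, of n] by (simp add: lc_def)
      then show ?thesis
        using U(1) vecs_mono [of n "Suc n"] by (auto simp: h_def)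
    qed
    moreover have "v(n := 1) \<in> h v"
      using upd_vecs [OF v] lin_0 [OF U(2)] by (simp add: h_def lc_def)
    moreover have "v(n := 1) \<notin> vecs n"
      using vecs_outside [of "v(n := 1)" n n] by auto
    ultimately show ?thesis
      by (auto simp: extensions_def h_def)
  qed
  have eq: "h v = H \<longleftrightarrow> v(n := 1) \<in> H" if v: "v \<in> vecs n" and H: "H \<in> extensions n U" for v H
  proof
    assume "h v = H"
    then show "v(n := 1) \<in> H"
      using upd_vecs [OF v] lin_0 [OF U(2)] by (auto simp: h_def lc_def)
  next
    assume w: "v(n := 1) \<in> H"
    have H': "H \<subseteq> vecs (Suc n)" "lin H" "H \<inter> vecs n = U"
      using H by (auto simp: extensions_def)
    \<comment> \<open>A vector is its projection plus a multiple of \<open>v(n := 1)\<close>, which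
      lies in \<open>H\<close>; hence \<open>H\<close> is determined by \<open>U\<close> and
      \<open>v\<close>.\<close>
    have iff: "g \<in> H \<longleftrightarrow> lc 1 g (- g n) (v(n := 1)) \<in> U" if g: "g \<in> vecs (Suc n)" for g
    proof
      assume "g \<in> H"
      then have "lc 1 g (- g n) (v(n := 1)) \<in> H"
        using linD [OF H'(2)] w by blast
      moreover have "lc 1 g (- g n) (v(n := 1)) n = 0"
        by (simp add: lc_def)
      ultimately show "lc 1 g (- g n) (v(n := 1)) \<in> U"
        using H' vecs_Suc_iff [of _ n] by auto
    next
      assume "lc 1 g (- g n) (v(n := 1)) \<in> U"
      then have "lc 1 (lc 1 g (- g n) (v(n := 1))) (g n) (v(n := 1)) \<in> H"
        using linD [OF H'(2)] w H'(3) by blast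
      also have "lc 1 (lc 1 g (- g n) (v(n := 1))) (g n) (v(n := 1)) = g"
        using vecs_mod [OF g] by (simp add: lc_def mod_simps)
      finally show "g \<in> H" .
    qed
    show "h v = H"
      using iff H'(1) by (auto simp: h_def)
  qed
  have "p ^ n = card (vecs n)"
    by (simp add: card_vecs)
  also have "\<dots> = (\<Sum>H\<in>extensions n U. card {v \<in> vecs n. h v = H})"
  proof -
    have "finite (extensions n U)" "h ` vecs n \<subseteq> extensions n U"
      using h finite_subsets_vecs by (auto simp: extensions_def)
    \<comment> \<open>The fibres of the map \<open>h\<close> partition \<open>vecs n\<close>;
      summing the constant 1 counts them.\<close>
    from sum.group [OF finite_vecs this, where h = "\<lambda>_. 1 :: nat"] show ?thesis
      by simp
  qed
  also have "\<dots> = (\<Sum>H\<in>extensions n U. card {v \<in> vecs n. v(n := 1) \<in> H})"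
    by (intro sum.cong refl arg_cong [of _ _ card]) (use eq in auto)
  also have "\<dots> = card (extensions n U) * card U"
    by (simp add: extension_section)
  finally show ?thesis
    by simp
qed


section \<open>Gaussian binomial coefficients\<close>

definition subspaces :: "nat \<Rightarrow> nat \<Rightarrow> (nat \<Rightarrow> int) set set" where
  "subspaces n k = {H. H \<subseteq> vecs n \<and> lin H \<and> card H = p ^ k}"

definition gauss :: "nat \<Rightarrow> nat \<Rightarrow> nat" where
  "gauss n k = card (subspaces n k)"

lemma finite_subspaces: "finite (subspaces n k)"
  using finite_subsets_vecs by (simp add: subspaces_def)

lemma subspaces_0: "subspaces n 0 = {{\<lambda>_. 0}}"
proof (intro equalityI subsetI)
  fix H assume "H \<in> subspaces n 0"
  then have "lin H" "card H = 1"
    by (auto simp: subspaces_def)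
  then show "H \<in> {{\<lambda>_. 0}}"
    by (metis card_1_singletonE lin_0 singletonD singletonI)
next
  fix H :: "(nat \<Rightarrow> int) set" assume "H \<in> {{\<lambda>_. 0}}"
  then show "H \<in> subspaces n 0"
    using lin_0 [OF lin_vecs, of n] by (simp add: subspaces_def lin_def lc_def)
qed

lemma gauss_0: "gauss n 0 = 1"
  by (simp add: gauss_def subspaces_0)

lemma gauss_eq_0: "n < k \<Longrightarrow> gauss n k = 0"
proof -
  assume "n < k"
  then have "card H \<noteq> p ^ k" if "H \<subseteq> vecs n" for H
    using card_mono [OF finite_vecs that] card_vecs p_gt_1
    by (metis leD nat_power_less_imp_less of_nat_1 of_nat_less_iff power_strict_increasing_iff)
  then have "subspaces n k = {}"
    by (auto simp: subspaces_def)
  then show ?thesis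
    by (simp add: gauss_def)
qed

lemma card_extensions_subspace:
  assumes "U \<in> subspaces n k" "k \<le> n"
  shows "card (extensions n U) = p ^ (n - k)"
proof -
  have "card (extensions n U) * p ^ k = p ^ (n - k) * p ^ k"
    using card_extensions [of U n] assms by (simp add: subspaces_def flip: power_add)
  then show ?thesis
    using p_pos by simp
qed

lemma extension_card: "H \<in> extensions n U \<Longrightarrow> card H = p * card U"
  using card_hyperplane_section by (auto simp: extensions_def)

text \<open>Subspaces of dimension \<open>k + 1\<close> that satisfy \<open>P\<close> either lie in the hyperplane \<open>vecs n\<close> or
  meet it in dimension \<open>k\<close>.\<close>

lemma card_subspaces_Suc:
  assumes "k \<le> n"
    and P: "\<And>H. H \<in> subspaces n (Suc k) \<Longrightarrow> P H"
    and Q: "\<And>H. lin H \<Longrightarrow> H \<subseteq> vecs (Suc n) \<Longrightarrow> \<not> H \<subseteq> vecs n \<Longrightarrow> P H \<longleftrightarrow> Q (H \<inter> vecs n)"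
  shows "card {H \<in> subspaces (Suc n) (Suc k). P H} =
    gauss n (Suc k) + card {U \<in> subspaces n k. Q U} * p ^ (n - k)"
proof -
  let ?U = "{U \<in> subspaces n k. Q U}"
  have "{H \<in> subspaces (Suc n) (Suc k). P H} = subspaces n (Suc k) \<union> (\<Union>U\<in>?U. extensions n U)"
    (is "?L = ?R")
  proof (intro equalityI subsetI)
    fix H assume H: "H \<in> ?L"
    show "H \<in> ?R"
    proof (cases "H \<subseteq> vecs n")
      case True
      with H show ?thesis by (auto simp: subspaces_def)
    next
      case False
      have "card (H \<inter> vecs n) = p ^ k"
        using card_hyperplane_section [of H n] H False p_pos by (auto simp: subspaces_def)
      then have "H \<inter> vecs n \<in> ?U"
        using H False Q [of H] lin_Int [OF _ lin_vecs] by (auto simp: subspaces_def)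
      moreover have "H \<in> extensions n (H \<inter> vecs n)"
        using H False by (auto simp: extensions_def subspaces_def)
      ultimately show ?thesis by blast
    qed
  next
    fix H assume "H \<in> ?R"
    then show "H \<in> ?L"
    proof
      assume "H \<in> subspaces n (Suc k)"
      then show ?thesis
        using P vecs_mono [of n "Suc n"] by (auto simp: subspaces_def)
    next
      assume "H \<in> (\<Union>U\<in>?U. extensions n U)"
      then obtain U where U: "U \<in> ?U" "H \<in> extensions n U" by blast
      then have "card H = p ^ Suc k"
        using extension_card by (simp add: subspaces_def)
      with U show ?thesis
        using Q by (auto simp: extensions_def subspaces_def)
    qed
  qed
  moreover have "subspaces n (Suc k) \<inter> (\<Union>U\<in>?U. extensions n U) = {}"
    by (auto simp: subspaces_def extensions_def)
  moreover have fin: "finite (extensions n U)" for U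
    using finite_subsets_vecs by (simp add: extensions_def)
  \<comment> \<open>Different \<open>U\<close> have disjoint families of extensions, since
    \<open>U\<close> is recovered from an extension as its section.\<close>
  moreover have "card (\<Union>U\<in>?U. extensions n U) = (\<Sum>U\<in>?U. card (extensions n U))"
    using fin finite_subspaces by (intro card_UN_disjoint) (auto simp: extensions_def)
  moreover have "(\<Sum>U\<in>?U. card (extensions n U)) = card ?U * p ^ (n - k)"
    using sum.cong [of ?U ?U "\<lambda>U. card (extensions n U)" "\<lambda>_. p ^ (n - k)"]
      card_extensions_subspace assms(1) by simp
  ultimately show ?thesis
    using finite_subspaces by (simp add: card_Un_disjoint gauss_def)
qed

text \<open>The q-Pascal rule is the preceding count with trivial conditions.\<close>

lemma gauss_Suc: "k \<le> n \<Longrightarrow> gauss (Suc n) (Suc k) = gauss n (Suc k) + p ^ (n - k) * gauss n k"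
  using card_subspaces_Suc [of k n "\<lambda>_. True" "\<lambda>_. True"] by (simp add: gauss_def)

lemma gauss_self: "gauss n n = 1"
proof (induction n)
  case (Suc n)
  then show ?case
    using gauss_Suc [of n n] gauss_eq_0 [of n "Suc n"] by simp
qed (simp add: gauss_0)

text \<open>The mirrored q-Pascal rule, obtained from \<open>gauss_Suc\<close> by induction instead
  of by duality of vector spaces; it serves to prove \<open>gauss_symmetric\<close>.\<close>

lemma gauss_Suc': "k \<le> n \<Longrightarrow> gauss (Suc n) (Suc k) = p ^ Suc k * gauss n (Suc k) + gauss n k"
proof (induction n arbitrary: k)
  case 0
  then show ?case
    using gauss_Suc [of 0 0] by (simp add: gauss_eq_0)
next
  case (Suc n)
  show ?case
  proof (cases "k = Suc n")
    case True
    then show ?thesis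
      by (simp add: gauss_self gauss_eq_0)
  next
    case False
    with Suc.prems have k: "k \<le> n" by simp
    show ?thesis
    proof (cases k)
      case 0
      have 1: "gauss (Suc (Suc n)) 1 = gauss (Suc n) 1 + p ^ Suc n"
        using gauss_Suc [of 0 "Suc n"] by (simp add: gauss_0)
      have 2: "gauss (Suc n) 1 = gauss n 1 + p ^ n"
        using gauss_Suc [of 0 n] by (simp add: gauss_0)
      have 3: "gauss (Suc n) 1 = p * gauss n 1 + 1"
        using Suc.IH [of 0] by (simp add: gauss_0)
      have "gauss (Suc (Suc n)) 1 = p * (gauss n 1 + p ^ n) + 1"
        unfolding 1 3 by (simp add: algebra_simps)
      then show ?thesis
        using 0 2 by (simp add: gauss_0)
    next
      case (Suc j)
      have e: "Suc n - k = n - j" "n - j = Suc (n - k)"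
        using Suc k by simp_all
      have "gauss (Suc (Suc n)) (Suc k) = gauss (Suc n) (Suc k) + p ^ (n - j) * gauss (Suc n) k"
        using gauss_Suc [of k "Suc n"] Suc.prems e(1) by simp
      also have "\<dots> = p ^ Suc k * gauss n (Suc k) + gauss n k
          + p ^ (n - j) * (p ^ k * gauss n k + gauss n j)"
        using Suc.IH [of k] Suc.IH [of j] Suc k by simp
      \<comment> \<open>With \<open>n - j = Suc (n - k)\<close>, the powers regroup as p^(n-j) p^k =
        p^(k+1) p^(n-k).\<close>
      also have "\<dots> = p ^ Suc k * (gauss n (Suc k) + p ^ (n - k) * gauss n k)
          + (gauss n k + p ^ (n - j) * gauss n j)"
        unfolding e(2) power_Suc by (simp add: algebra_simps)
      also have "\<dots> = p ^ Suc k * gauss (Suc n) (Suc k) + gauss (Suc n) k"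
        using gauss_Suc [of k n] gauss_Suc [of j n] Suc k by simp
      finally show ?thesis .
    qed
  qed
qed

text \<open>The two q-Pascal rules are exchanged by replacing \<open>k\<close> with
  \<open>n - k\<close>, so the induction closes.\<close>

lemma gauss_symmetric: "k \<le> n \<Longrightarrow> gauss n k = gauss n (n - k)"
proof (induction n arbitrary: k)
  case (Suc n)
  show ?case
  proof (cases k)
    case 0
    then show ?thesis by (simp add: gauss_0 gauss_self)
  next
    case (Suc j)
    show ?thesis
    proof (cases "j = n")
      case True
      then show ?thesis by (simp add: gauss_0 gauss_self Suc)
    next
      case False
      then have j: "Suc j \<le> n" using Suc Suc.prems by simp
      then obtain i where i: "n - j = Suc i" "n - Suc j = i" "i \<le> n"
        by (metis Suc_diff_Suc Suc_le_lessD diff_le_self)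
      have "gauss (Suc n) (Suc n - k) = p ^ (n - j) * gauss n (n - j) + gauss n (n - Suc j)"
        using gauss_Suc' [of i n] i Suc by simp
      also have "\<dots> = gauss (Suc n) k"
        using gauss_Suc [of j n] j Suc.IH [of j] Suc.IH [of "Suc j"] Suc by simp
      finally show ?thesis by simp
    qed
  qed
qed (simp add: gauss_0)

section \<open>Subalgebras in coordinates\<close>

text \<open>The adjoint action of \<open>x\<^sub>0\<close> on the abelian ideal \<open>\<langle>x\<^sub>1, \<dots>, x\<^sub>c\<rangle>\<close> of \<open>M\<^sub>c(\<F>\<^sub>p)\<close> is a single
  nilpotent Jordan block; it is the shift when \<open>x\<^sub>j\<close> is given coordinate \<open>c - j\<close>.\<close>

definition shift :: "(nat \<Rightarrow> int) \<Rightarrow> nat \<Rightarrow> int" where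
  "shift f = (\<lambda>i. f (Suc i))"

text \<open>Coordinate \<open>c\<close> is the coefficient of x_0. Both shifts also move it into
  position \<open>c - 1\<close>, the place of x_1, but there the two products cancel.\<close>

definition brac :: "nat \<Rightarrow> (nat \<Rightarrow> int) \<Rightarrow> (nat \<Rightarrow> int) \<Rightarrow> nat \<Rightarrow> int" where
  "brac c f g = lc (f c) (shift g) (- g c) (shift f)"

lemma shift_vecs: "f \<in> vecs (Suc n) \<Longrightarrow> shift f \<in> vecs n"
  by (auto simp: shift_def vecs_def)

lemma shift_vecs_mono: "f \<in> vecs n \<Longrightarrow> shift f \<in> vecs n"
  using shift_vecs [of f n] vecs_mono [of n "Suc n"] by auto

text \<open>\<open>H\<close> meets \<open>vecs (Suc n)\<close> in a subspace strictly larger than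
  the hyperplane, which by cardinality is everything.\<close>

lemma vecs_subset_lin:
  assumes H: "lin H" and n: "vecs n \<subseteq> H" and f: "f \<in> H" "f \<in> vecs (Suc n)" "f n \<noteq> 0"
  shows "vecs (Suc n) \<subseteq> H"
proof -
  have "lin (H \<inter> vecs (Suc n))"
    by (rule lin_Int [OF H lin_vecs])
  moreover have "\<not> H \<inter> vecs (Suc n) \<subseteq> vecs n"
    using f vecs_Suc_iff by blast
  ultimately have "card (H \<inter> vecs (Suc n)) = p * card (H \<inter> vecs (Suc n) \<inter> vecs n)"
    by (intro card_hyperplane_section) auto
  also have "H \<inter> vecs (Suc n) \<inter> vecs n = vecs n"
    using n vecs_mono [of n "Suc n"] by auto
  finally have "card (H \<inter> vecs (Suc n)) = card (vecs (Suc n))"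
    by (simp add: card_vecs)
  then have "H \<inter> vecs (Suc n) = vecs (Suc n)"
    by (intro card_subset_eq finite_vecs) auto
  then show ?thesis
    by blast
qed

text \<open>A nilpotent Jordan block has only the standard flag as invariant subspaces. The
  induction is on the ambient dimension, applied to the section of \<open>W\<close> by the
  hyperplane.\<close>

lemma shift_invariant:
  assumes "lin W" "W \<subseteq> vecs n" "\<forall>f\<in>W. shift f \<in> W"
  shows "\<exists>d\<le>n. W = vecs d"
  using assms
proof (induction n arbitrary: W)
  case 0
  then have "W = vecs 0"
    using lin_0 [OF 0(1)] by (auto simp: vecs_0)
  then show ?case by auto
next
  case (Suc n)
  show ?case
  proof (cases "W \<subseteq> vecs n")
    case True
    then show ?thesis
      using Suc.IH [of W] Suc.prems le_SucI by blast
  next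
    case False
    then obtain f where f: "f \<in> W" "f \<in> vecs (Suc n)" "f n \<noteq> 0"
      using Suc.prems(2) vecs_Suc_iff by blast
    have "\<exists>d\<le>n. W \<inter> vecs n = vecs d"
      using Suc.IH [of "W \<inter> vecs n"] Suc.prems lin_Int [OF _ lin_vecs] shift_vecs_mono by auto
    then obtain d where d: "d \<le> n" "W \<inter> vecs n = vecs d" by blast
    \<comment> \<open>The shift moves the nonzero entry \<open>f n\<close> to position
      \<open>n - 1\<close>, so the section already fills the hyperplane.\<close>
    have "d = n"
    proof (rule ccontr)
      assume "d \<noteq> n"
      with d(1) obtain m where m: "n = Suc m" "d \<le> m"
        by (cases n) auto
      have "shift f \<in> vecs d"
        using f Suc.prems shift_vecs d(2) by blast
      then have "shift f m = 0"
        using vecs_outside m by blast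
      with f m show False
        by (simp add: shift_def)
    qed
    then have "vecs (Suc n) \<subseteq> W"
      using vecs_subset_lin [OF Suc.prems(1) _ f] d by blast
    then show ?thesis
      using Suc.prems by blast
  qed
qed

section \<open>Counting subalgebras in coordinates\<close>

definition subalgs :: "nat \<Rightarrow> nat \<Rightarrow> (nat \<Rightarrow> int) set set" where
  "subalgs c k = {H \<in> subspaces (Suc c) k. \<forall>f\<in>H. \<forall>g\<in>H. brac c f g \<in> H}"

text \<open>A vector of \<open>H\<close> with x_0-coefficient 1 acts on the abelian ideal
  \<open>vecs c\<close> as x_0 does, by the shift; conversely every bracket of vectors of
  \<open>H\<close> is the shift of a vector in the section.\<close>

lemma brac_closed_iff:
  assumes H: "lin H" "H \<subseteq> vecs (Suc c)" "\<not> H \<subseteq> vecs c"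
  shows "(\<forall>f\<in>H. \<forall>g\<in>H. brac c f g \<in> H) \<longleftrightarrow> (\<forall>f\<in>H \<inter> vecs c. shift f \<in> H \<inter> vecs c)"
    (is "?L \<longleftrightarrow> ?R")
proof -
  obtain w where w: "w \<in> H" "w c = 1"
    using lin_normalise [OF H] .
  show ?thesis
  proof
    assume L: ?L
    show ?R
    proof
      fix f assume f: "f \<in> H \<inter> vecs c"
      then have s: "shift f \<in> vecs c"
        using shift_vecs_mono by blast
      have "brac c w f = shift f"
        using f w vecs_outside [of f c c] vecs_mod [OF s] by (simp add: brac_def lc_def)
      moreover have "brac c w f \<in> H"
        using L f w by blast
      ultimately show "shift f \<in> H \<inter> vecs c"
        using s by simp
    qed
  next
    assume R: ?R
    show ?L
    proof (intro ballI)
      fix f g assume f: "f \<in> H" and g: "g \<in> H"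
      \<comment> \<open>\<open>[f, g] = [w, f\<^sub>c g - g\<^sub>c f]\<close>, because \<open>f - f\<^sub>c w\<close> and \<open>g - g\<^sub>c w\<close> commute\<close>
      define h where "h = lc (f c) g (- g c) f"
      have "h \<in> H"
        unfolding h_def by (rule linD [OF H(1) g f])
      moreover have "h c = 0"
        by (simp add: h_def lc_def)
      ultimately have "shift h \<in> H"
        using R H(2) vecs_Suc_iff [of h c] by auto
      moreover have "brac c f g = shift h"
        by (simp add: h_def brac_def lc_def shift_def)
      ultimately show "brac c f g \<in> H"
        by simp
    qed
  qed
qed

lemma card_subalgs_0: "card (subalgs c 0) = 1"
proof -
  have "brac c f g \<in> H" if "H \<in> subspaces (Suc c) 0" "f \<in> H" "g \<in> H" for f g H
    using that by (simp add: subspaces_0 brac_def lc_def shift_def)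
  then have "subalgs c 0 = subspaces (Suc c) 0"
    by (auto simp: subalgs_def)
  then show ?thesis
    using gauss_0 by (simp add: gauss_def)
qed

text \<open>Every subspace of the abelian ideal counts; outside it exactly the extensions of
  \<open>vecs k\<close> do, this being the only invariant subspace of dimension
  \<open>k\<close>.\<close>

lemma card_subalgs_Suc:
  assumes "k \<le> c"
  shows "card (subalgs c (Suc k)) = gauss c (Suc k) + p ^ (c - k)"
proof -
  have "{U \<in> subspaces c k. \<forall>f\<in>U. shift f \<in> U} = {vecs k}" (is "?S = _")
  proof (intro equalityI subsetI)
    fix U assume "U \<in> ?S"
    then have U: "U \<subseteq> vecs c" "lin U" "card U = p ^ k" "\<forall>f\<in>U. shift f \<in> U"
      by (auto simp: subspaces_def)
    then obtain d where "U = vecs d"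
      using shift_invariant by blast
    moreover from this have "d = k"
      using U(3) p_gt_1 by (simp add: card_vecs power_inject_exp)
    ultimately show "U \<in> {vecs k}" by simp
  next
    show "U \<in> ?S" if "U \<in> {vecs k}" for U
      using that vecs_mono [OF assms] lin_vecs shift_vecs_mono
      by (auto simp: subspaces_def card_vecs)
  qed
  moreover have "brac c f g \<in> H" if "H \<in> subspaces c (Suc k)" "f \<in> H" "g \<in> H" for f g H
  proof -
    have "f c = 0" "g c = 0"
      using that vecs_outside by (auto simp: subspaces_def)
    then have "brac c f g = (\<lambda>_. 0)"
      by (simp add: brac_def lc_def)
    then show ?thesis
      using that lin_0 by (auto simp: subspaces_def)
  qed
  ultimately show ?thesis
    using card_subspaces_Suc [OF assms, of "\<lambda>H. \<forall>f\<in>H. \<forall>g\<in>H. brac c f g \<in> H"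
        "\<lambda>U. \<forall>f\<in>U. shift f \<in> U"] brac_closed_iff
    by (simp add: subalgs_def)
qed

end

section \<open>Vector spaces over a prime field\<close>

text \<open>The finite carrier generates the space, so a finite basis exists, and vectors correspond
  to coefficient functions on it.\<close>

lemma (in vectorspace) card_eq_power_dim:
  assumes "finite (carrier V)"
  shows "card (carrier V) = card (carrier K) ^ dim"
proof -
  have "gen_set (carrier V)"
    using in_own_span [of "carrier V"] span_is_subset2 [of "carrier V"] by auto
  then have "fin_dim"
    using assms unfolding fin_dim_def by blast
  then obtain B where B: "finite B" "basis B"
    using finite_basis_exists by blast
  then have BV: "B \<subseteq> carrier V"
    by (simp add: basis_def)
  have "\<forall>v. v \<in> carrier V \<longrightarrow> (\<exists>!a. a \<in> B \<rightarrow>\<^sub>E carrier K \<and> lincomb a B = v)"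
    using basis_criterion [OF B(1) BV] B(2) by blast
  moreover have "lincomb a B \<in> carrier V" if "a \<in> B \<rightarrow>\<^sub>E carrier K" for a
    using that BV by (intro lincomb_closed) auto
  ultimately have "bij_betw (\<lambda>a. lincomb a B) (B \<rightarrow>\<^sub>E carrier K) (carrier V)"
    by (intro bij_betwI') metis+
  then have "card (carrier V) = card (B \<rightarrow>\<^sub>E carrier K)"
    by (simp add: bij_betw_same_card)
  also have "\<dots> = card (carrier K) ^ dim"
    using B dim_basis by (simp add: card_PiE)
  finally show ?thesis .
qed

section \<open>Coordinates on a vector space over a prime field\<close>

context prime_modulus
begin

lemma field_GFp: "field (GFp p)"
proof -
  have "residues_prime p"
    by unfold_locales (rule prime_p)
  then show ?thesis
    by (rule residues_prime.is_field)
qed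

lemma GFp_simps [simp]:
  "carrier (GFp p) = {0..<int p}" "\<one>\<^bsub>GFp p\<^esub> = 1" "\<zero>\<^bsub>GFp p\<^esub> = 0"
  "a \<oplus>\<^bsub>GFp p\<^esub> b = (a + b) mod int p" "a \<otimes>\<^bsub>GFp p\<^esub> b = a * b mod int p"
  by (auto simp: residue_ring_def)

end

text \<open>No vector space laws are assumed: they are pulled back along the bijection with
  \<open>vecs n\<close>. The instances are the function space behind the Gaussian binomials and the
  reduction of \<open>M c\<close>.\<close>

locale coordinates = prime_modulus +
  fixes V :: "(int, 'a, 'm) module_scheme" (structure) and \<psi> :: "'a \<Rightarrow> nat \<Rightarrow> int" and n :: nat
  assumes bij: "bij_betw \<psi> (carrier V) (vecs n)"
    and zero_mem: "\<zero> \<in> carrier V"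
    and add_mem: "\<lbrakk>x \<in> carrier V; y \<in> carrier V\<rbrakk> \<Longrightarrow> x \<oplus> y \<in> carrier V"
    and smult_mem: "\<lbrakk>0 \<le> a; a < int p; x \<in> carrier V\<rbrakk> \<Longrightarrow> a \<odot>\<^bsub>V\<^esub> x \<in> carrier V"
    and \<psi>_zero: "\<psi> \<zero> = (\<lambda>_. 0)"
    and \<psi>_add: "\<lbrakk>x \<in> carrier V; y \<in> carrier V\<rbrakk> \<Longrightarrow> \<psi> (x \<oplus> y) = lc 1 (\<psi> x) 1 (\<psi> y)"
    and \<psi>_smult: "\<lbrakk>0 \<le> a; a < int p; x \<in> carrier V\<rbrakk> \<Longrightarrow> \<psi> (a \<odot>\<^bsub>V\<^esub> x) = lc a (\<psi> x) 0 (\<psi> x)"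
begin

lemma \<psi>_eqI: "\<lbrakk>x \<in> carrier V; y \<in> carrier V; \<psi> x = \<psi> y\<rbrakk> \<Longrightarrow> x = y"
  using bij by (auto simp: bij_betw_def inj_on_def)

lemma \<psi>_mem: "x \<in> carrier V \<Longrightarrow> \<psi> x \<in> vecs n"
  using bij by (auto simp: bij_betw_def)

lemma \<psi>_mod: "x \<in> carrier V \<Longrightarrow> \<psi> x i mod int p = \<psi> x i"
  using \<psi>_mem vecs_mod by blast

lemma vectorspace_V: "vectorspace (GFp p) V"
proof (rule vs_criteria [OF field_GFp])
  show "\<forall>v\<in>carrier V. \<exists>neg_v\<in>carrier V. v \<oplus> neg_v = \<zero>"
  proof
    fix v assume v: "v \<in> carrier V"
    have m: "0 \<le> int p - 1" "int p - 1 < int p"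
      using p_gt_1 by auto
    \<comment> \<open>Scalars must be reduced residues, so \<open>int p - 1\<close> plays the part
      of -1.\<close>
    have "v \<oplus> (int p - 1) \<odot>\<^bsub>V\<^esub> v = \<zero>"
      using v m by (intro \<psi>_eqI)
        (simp_all add: zero_mem add_mem smult_mem \<psi>_zero \<psi>_add \<psi>_smult lc_def mod_simps left_diff_distrib)
    then show "\<exists>neg_v\<in>carrier V. v \<oplus> neg_v = \<zero>"
      using smult_mem [OF m v] by blast
  qed
  show "\<forall>a b v. a \<in> carrier (GFp p) \<and> b \<in> carrier (GFp p) \<and> v \<in> carrier V \<longrightarrow>
      (a \<otimes>\<^bsub>GFp p\<^esub> b) \<odot>\<^bsub>V\<^esub> v = a \<odot>\<^bsub>V\<^esub> (b \<odot>\<^bsub>V\<^esub> v)"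
  proof (intro allI impI, elim conjE)
    fix a b v assume *: "a \<in> carrier (GFp p)" "b \<in> carrier (GFp p)" and v: "v \<in> carrier V"
    then have a: "0 \<le> a" "a < int p" and b: "0 \<le> b" "b < int p"
      and ab: "0 \<le> a * b mod int p" "a * b mod int p < int p"
      using p_pos by auto
    show "(a \<otimes>\<^bsub>GFp p\<^esub> b) \<odot>\<^bsub>V\<^esub> v = a \<odot>\<^bsub>V\<^esub> (b \<odot>\<^bsub>V\<^esub> v)"
      using a b ab v
      by (intro \<psi>_eqI) (simp_all add: \<psi>_smult smult_mem lc_def mod_simps mult.assoc)
  qed
  show "\<forall>a b v. a \<in> carrier (GFp p) \<and> b \<in> carrier (GFp p) \<and> v \<in> carrier V \<longrightarrow>
      (a \<oplus>\<^bsub>GFp p\<^esub> b) \<odot>\<^bsub>V\<^esub> v = a \<odot>\<^bsub>V\<^esub> v \<oplus> b \<odot>\<^bsub>V\<^esub> v"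
  proof (intro allI impI, elim conjE)
    fix a b v assume *: "a \<in> carrier (GFp p)" "b \<in> carrier (GFp p)" and v: "v \<in> carrier V"
    then have a: "0 \<le> a" "a < int p" and b: "0 \<le> b" "b < int p"
      and ab: "0 \<le> (a + b) mod int p" "(a + b) mod int p < int p"
      using p_pos by auto
    show "(a \<oplus>\<^bsub>GFp p\<^esub> b) \<odot>\<^bsub>V\<^esub> v = a \<odot>\<^bsub>V\<^esub> v \<oplus> b \<odot>\<^bsub>V\<^esub> v"
      using a b ab v
      by (intro \<psi>_eqI) (simp_all add: \<psi>_smult \<psi>_add smult_mem add_mem lc_def mod_simps distrib_right)
  qed
  show "\<forall>a v w. a \<in> carrier (GFp p) \<and> v \<in> carrier V \<and> w \<in> carrier V \<longrightarrow>
      a \<odot>\<^bsub>V\<^esub> (v \<oplus> w) = a \<odot>\<^bsub>V\<^esub> v \<oplus> a \<odot>\<^bsub>V\<^esub> w"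
    by (intro allI impI \<psi>_eqI)
      (simp_all add: \<psi>_smult \<psi>_add smult_mem add_mem lc_def mod_simps distrib_left)
  show "\<forall>v\<in>carrier V. \<one>\<^bsub>GFp p\<^esub> \<odot>\<^bsub>V\<^esub> v = v"
  proof
    fix v assume v: "v \<in> carrier V"
    have 1: "0 \<le> (1 :: int)" "1 < int p"
      using p_gt_1 by auto
    have "1 \<odot>\<^bsub>V\<^esub> v = v"
      by (rule \<psi>_eqI [OF smult_mem [OF 1 v] v])
        (simp add: \<psi>_smult [OF 1 v] lc_def \<psi>_mod [OF v])
    then show "\<one>\<^bsub>GFp p\<^esub> \<odot>\<^bsub>V\<^esub> v = v"
      by simp
  qed
  show "\<forall>v w x. v \<in> carrier V \<and> w \<in> carrier V \<and> x \<in> carrier V \<longrightarrow> v \<oplus> w \<oplus> x = v \<oplus> (w \<oplus> x)"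
    by (intro allI impI \<psi>_eqI) (simp_all add: \<psi>_add add_mem lc_def mod_simps add.assoc)
  show "\<forall>v w. v \<in> carrier V \<and> w \<in> carrier V \<longrightarrow> v \<oplus> w = w \<oplus> v"
    by (intro allI impI \<psi>_eqI) (simp_all add: \<psi>_add add_mem lc_def add.commute)
  show "\<forall>v\<in>carrier V. v \<oplus> \<zero> = v"
    by (intro ballI \<psi>_eqI) (simp_all add: \<psi>_add \<psi>_zero add_mem zero_mem lc_def \<psi>_mod)
qed (auto simp: zero_mem add_mem smult_mem)

lemma subspace_iff:
  assumes H: "H \<subseteq> carrier V"
  shows "VectorSpace.subspace (GFp p) H V \<longleftrightarrow> lin (\<psi> ` H)"
proof
  assume "VectorSpace.subspace (GFp p) H V"
  then interpret H: submodule "GFp p" H V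
    by (simp add: subspace_def)
  show "lin (\<psi> ` H)"
    unfolding lin_def
  proof (intro conjI ballI allI)
    show "(\<lambda>_. 0) \<in> \<psi> ` H"
      using \<psi>_zero H.zero_closed by (metis imageI)
    fix f g a b assume "f \<in> \<psi> ` H" "g \<in> \<psi> ` H"
    then obtain x y where xy: "f = \<psi> x" "g = \<psi> y" "x \<in> H" "y \<in> H" by blast
    \<comment> \<open>\<open>lin\<close> admits all integer coefficients, while scalars of the field
      are residues; hence the reduction first.\<close>
    let ?z = "(a mod int p) \<odot>\<^bsub>V\<^esub> x \<oplus> (b mod int p) \<odot>\<^bsub>V\<^esub> y"
    have "?z \<in> H"
      using xy p_pos by (intro H.m_closed H.smult_closed) auto
    moreover have "\<psi> ?z = lc a f b g"
      using xy H p_pos by (subst \<psi>_add) (auto simp: \<psi>_smult smult_mem lc_def mod_simps subset_iff)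
    ultimately show "lc a f b g \<in> \<psi> ` H"
      by (metis imageI)
  qed
next
  assume lin: "lin (\<psi> ` H)"
  interpret vectorspace "GFp p" V
    by (rule vectorspace_V)
  have mem: "x \<in> H" if "x \<in> carrier V" "\<psi> x \<in> \<psi> ` H" for x
    using that bij H by (auto simp: bij_betw_def inj_on_def)
  have "submodule (GFp p) H V"
  proof
    show "H \<subseteq> carrier V" by (rule H)
    show "\<zero> \<in> H"
      using mem [OF zero_mem] lin_0 [OF lin] \<psi>_zero by simp
    show "v \<oplus> w \<in> H" if "v \<in> H" "w \<in> H" for v w
      using that H lin by (intro mem) (auto simp: subset_iff add_mem \<psi>_add intro: linD)
    show "a \<odot>\<^bsub>V\<^esub> v \<in> H" if "a \<in> carrier (GFp p)" "v \<in> H" for a v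
      using that H lin by (intro mem) (auto simp: subset_iff smult_mem \<psi>_smult intro: linD)
  qed
  then show "VectorSpace.subspace (GFp p) H V"
    using vectorspace_V by (simp add: subspace_def)
qed

lemma dim_subspace:
  assumes "VectorSpace.subspace (GFp p) H V"
  shows "card (\<psi> ` H) = p ^ vectorspace.dim (GFp p) (V\<lparr>carrier := H\<rparr>)"
proof -
  interpret vectorspace "GFp p" V
    by (rule vectorspace_V)
  interpret W: vectorspace "GFp p" "V\<lparr>carrier := H\<rparr>"
    by (rule subspace_is_vs [OF assms])
  have H: "H \<subseteq> carrier V"
    using assms by (simp add: subspace_def submodule_def)
  have inj: "inj_on \<psi> H"
    using bij H by (auto simp: bij_betw_def intro: inj_on_subset)
  have "finite (carrier V)"
    using bij finite_vecs bij_betw_finite by blast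
  then have "finite (carrier (V\<lparr>carrier := H\<rparr>))"
    using H finite_subset by auto
  from W.card_eq_power_dim [OF this] show ?thesis
    using card_image [OF inj] by simp
qed

lemma dim_V: "vectorspace.dim (GFp p) V = n"
proof -
  interpret vectorspace "GFp p" V
    by (rule vectorspace_V)
  have "finite (carrier V)" "card (carrier V) = p ^ n"
    using bij finite_vecs bij_betw_finite bij_betw_same_card card_vecs by metis+
  with card_eq_power_dim have "p ^ n = p ^ dim"
    by simp
  then show ?thesis
    using p_gt_1 by (simp add: power_inject_exp)
qed

text \<open>\<open>P\<close> and \<open>Q\<close> are one condition, stated in \<open>V\<close> and
  in coordinates: trivial for the Gaussian binomials, closure under brackets for the
  subalgebras.\<close>

lemma card_subspaces_transport:
  assumes "\<And>H. VectorSpace.subspace (GFp p) H V \<Longrightarrow> P H \<longleftrightarrow> Q (\<psi> ` H)"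
  shows "card {H. VectorSpace.subspace (GFp p) H V \<and> P H \<and>
      vectorspace.dim (GFp p) (V\<lparr>carrier := H\<rparr>) = k} = card {H \<in> subspaces n k. Q H}"
proof -
  have "bij_betw ((`) \<psi>) {H \<in> Pow (carrier V). VectorSpace.subspace (GFp p) H V \<and> P H \<and>
      vectorspace.dim (GFp p) (V\<lparr>carrier := H\<rparr>) = k} {H \<in> Pow (vecs n). H \<in> subspaces n k \<and> Q H}"
  proof (rule bij_betw_Collect [OF bij_betw_Pow [OF bij]])
    fix H assume "H \<in> Pow (carrier V)"
    then have H: "H \<subseteq> carrier V" by simp
    have "\<psi> ` H \<subseteq> vecs n"
      using H \<psi>_mem by blast
    then show "(\<psi> ` H \<in> subspaces n k \<and> Q (\<psi> ` H)) = (VectorSpace.subspace (GFp p) H V \<and> P H \<and>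
        vectorspace.dim (GFp p) (V\<lparr>carrier := H\<rparr>) = k)"
      using dim_subspace [of H] subspace_iff [OF H] assms [of H] p_gt_1
      by (auto simp: subspaces_def power_inject_exp)
  qed
  moreover have "{H \<in> Pow (carrier V). VectorSpace.subspace (GFp p) H V \<and> P H \<and>
      vectorspace.dim (GFp p) (V\<lparr>carrier := H\<rparr>) = k} = {H. VectorSpace.subspace (GFp p) H V \<and> P H \<and>
      vectorspace.dim (GFp p) (V\<lparr>carrier := H\<rparr>) = k}"
    by (auto simp: subspace_def dest: submodule.subset)
  moreover have "{H \<in> Pow (vecs n). H \<in> subspaces n k \<and> Q H} = {H \<in> subspaces n k. Q H}"
    by (auto simp: subspaces_def)
  ultimately show ?thesis
    by (simp add: bij_betw_same_card)
qed

end

section \<open>Gaussian binomials as counts of coordinate subspaces\<close>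

context prime_modulus
begin

lemma gauss_binomial_eq: "gauss_binomial p n k = gauss n k"
proof -
  interpret field "GFp p"
    by (rule field_GFp)
  \<comment> \<open>Vectors of the function space are \<open>undefined\<close> outside the index
    set, those of \<open>vecs n\<close> are zero there; the bijection exchanges the default
    value.\<close>
  have "bij_betw (\<lambda>f i. if i < n then f i else 0) ({..<n} \<rightarrow>\<^sub>E {0..<int p}) (vecs n)"
  proof (rule bij_betw_byWitness [where f' = "\<lambda>f. restrict f {..<n}"])
    show "\<forall>f\<in>{..<n} \<rightarrow>\<^sub>E {0..<int p}. (\<lambda>i\<in>{..<n}. if i < n then f i else 0) = f"
    proof (intro ballI ext)
      fix f :: "nat \<Rightarrow> int" and i assume "f \<in> {..<n} \<rightarrow>\<^sub>E {0..<int p}"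
      then show "(\<lambda>i\<in>{..<n}. if i < n then f i else 0) i = f i"
        using PiE_arb [of f "{..<n}" _ i] by (cases "i < n") simp_all
    qed
    show "\<forall>f\<in>vecs n. (\<lambda>i. if i < n then (\<lambda>i\<in>{..<n}. f i) i else 0) = f"
      by (auto simp: vecs_def)
    show "(\<lambda>f i. if i < n then f i else 0) ` ({..<n} \<rightarrow>\<^sub>E {0..<int p}) \<subseteq> vecs n"
    proof (rule image_subsetI)
      fix f assume "f \<in> {..<n} \<rightarrow>\<^sub>E {0..<int p}"
      then have "f i \<in> {0..<int p}" if "i < n" for i
        using that PiE_mem by blast
      then show "(\<lambda>i. if i < n then f i else 0) \<in> vecs n"
        by (simp add: vecs_def)
    qed
    show "(\<lambda>f. restrict f {..<n}) ` vecs n \<subseteq> {..<n} \<rightarrow>\<^sub>E {0..<int p}"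
      by (rule image_subsetI) (simp add: vecs_def restrict_PiE_iff)
  qed
  then interpret coordinates p "func_space {..<n}" "\<lambda>f i. if i < n then f i else 0" n
    using p_pos by unfold_locales
      (simp_all add: func_space_def lc_def fun_eq_iff Pi_iff PiE_def)
  show ?thesis
    using card_subspaces_transport [of "\<lambda>_. True" "\<lambda>_. True" k]
    by (simp add: gauss_binomial_def gauss_def)
qed

end

section \<open>The tensor product with a prime field\<close>

text \<open>The map sending x \<otimes> a to a x. As \<open>a\<close> is a residue representative,
  it respects the tensor relations only modulo \<open>p\<close>.\<close>

definition eval_tensor :: "(('i \<Rightarrow>\<^sub>0 int) \<times> int \<Rightarrow>\<^sub>0 int) \<Rightarrow> 'i \<Rightarrow>\<^sub>0 int" where
  "eval_tensor = frag_extend (\<lambda>(x, a). frag_cmul a x)"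

lemma eval_tensor_simps [simp]:
  "eval_tensor 0 = 0"
  "eval_tensor (frag_of (x, a)) = frag_cmul a x"
  "eval_tensor (f + g) = eval_tensor f + eval_tensor g"
  "eval_tensor (f - g) = eval_tensor f - eval_tensor g"
  "eval_tensor (- f) = - eval_tensor f"
  by (simp_all add: eval_tensor_def frag_extend_add frag_extend_diff frag_extend_minus)

lemma keys_eval_tensor:
  assumes "Poly_Mapping.keys f \<subseteq> {x. Poly_Mapping.keys x \<subseteq> I} \<times> A"
  shows "Poly_Mapping.keys (eval_tensor f) \<subseteq> I"
  unfolding eval_tensor_def
  by (rule order_trans [OF keys_frag_extend]) (use assms keys_cmul in fastforce)

context prime_modulus
begin

lemma add_pow_GFp:
  assumes "0 \<le> a" "a < int p"
  shows "add_pow (GFp p) (n :: int) a = n * a mod int p"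
proof -
  interpret field "GFp p"
    by (rule field_GFp)
  have nat: "add_pow (GFp p) k a = int k * a mod int p" for k :: nat
    by (induction k) (use assms in \<open>simp_all add: add.nat_pow_Suc mod_simps algebra_simps\<close>)
  show ?thesis
  proof (cases "n \<ge> 0")
    case True
    then show ?thesis
      by (simp add: add_pow_int_ge nat)
  next
    case False
    \<comment> \<open>For negative \<open>n\<close> the claimed value is recognised as the additive
      inverse of a natural multiple.\<close>
    have "n * a mod int p \<oplus>\<^bsub>GFp p\<^esub> add_pow (GFp p) (nat (- n)) a = \<zero>\<^bsub>GFp p\<^esub>"
      using False by (simp add: nat mod_simps)
    then have "\<ominus>\<^bsub>GFp p\<^esub> add_pow (GFp p) (nat (- n)) a = n * a mod int p"
      by (rule minus_equality) (use p_pos in \<open>simp_all add: nat\<close>)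
    then show ?thesis
      using False by (simp add: add_pow_int_lt)
  qed
qed

text \<open>This is the isomorphism of L \<otimes> F_p with L / pL for free L: modulo the relators
  every tensor equals x \<otimes> 1, with x its evaluation, and this vanishes when \<open>p\<close>
  divides x.\<close>

lemma generate_tensor_relators:
  fixes L :: "(int, 'i \<Rightarrow>\<^sub>0 int, 'm) module_scheme" and I :: "'i set"
  assumes L: "carrier L = {x. Poly_Mapping.keys x \<subseteq> I}" "add L = (+)" "smult L = frag_cmul"
  defines "F \<equiv> free_Abelian_group (carrier L \<times> carrier (GFp p))"
  shows "generate F (tensor_relators L (GFp p)) =
      {f \<in> carrier F. \<forall>k. int p dvd Poly_Mapping.lookup (eval_tensor f) k}"
    (is "?N = ?Ker")
proof (rule equalityI)
  interpret F: group F
    by (simp add: F_def)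
  have F_simps: "f \<otimes>\<^bsub>F\<^esub> g = f + g" "\<one>\<^bsub>F\<^esub> = 0" for f g
    by (simp_all add: F_def)
  have F_inv: "inv\<^bsub>F\<^esub> f = - f" if "f \<in> carrier F" for f
    using that by (simp add: F_def)
  have F_diff: "f - g \<in> carrier F" if "f \<in> carrier F" "g \<in> carrier F" for f g
    using that keys_diff [of f g] by (auto simp: F_def)
  have F_of: "frag_of (x, a) \<in> carrier F \<longleftrightarrow> x \<in> carrier L \<and> 0 \<le> a \<and> a < int p" for x a
    by (simp add: F_def)
  have L_add: "x + y \<in> carrier L" and L_diff: "x - y \<in> carrier L"
    if "x \<in> carrier L" "y \<in> carrier L" for x y
    using that keys_add [of x y] keys_diff [of x y] by (auto simp: L)
  have L_cmul: "frag_cmul n x \<in> carrier L" if "x \<in> carrier L" for n x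
    using that keys_cmul [of n x] by (auto simp: L)
  have L_0: "0 \<in> carrier L"
    by (simp add: L)
  have p01: "0 \<le> (1 :: int)" "1 < int p" "0 < int p"
    using p_gt_1 by auto
  have mod_dvd: "int p dvd a mod int p * l - a * l" for a l
    by (metis mod_eq_dvd_iff mod_mult_left_eq)
  \<comment> \<open>A relator evaluates to 0 or to a residue's reduction error times x, a multiple
    of \<open>p\<close>.\<close>
  have rel: "tensor_relators L (GFp p) \<subseteq> ?Ker"
  proof
    fix f assume "f \<in> tensor_relators L (GFp p)"
    then consider
      (left) x y a where "f = frag_of (x + y, a) - frag_of (x, a) - frag_of (y, a)"
        "x \<in> carrier L" "y \<in> carrier L" "0 \<le> a" "a < int p"
      | (right) x a b where "f = frag_of (x, (a + b) mod int p) - frag_of (x, a) - frag_of (x, b)"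
        "x \<in> carrier L" "0 \<le> a" "a < int p" "0 \<le> b" "b < int p"
      | (scalar) n x a where "f = frag_of (frag_cmul n x, a) - frag_of (x, n * a mod int p)"
        "x \<in> carrier L" "0 \<le> a" "a < int p"
      by (fastforce simp: tensor_relators_def L(2,3) add_pow_GFp)
    then show "f \<in> ?Ker"
    proof cases
      case left
      then have "f \<in> carrier F"
        by (simp add: F_diff F_of L_add)
      moreover have "eval_tensor f = 0"
        by (simp add: left(1) frag_cmul_distrib2)
      ultimately show ?thesis
        by simp
    next
      case right
      then have "f \<in> carrier F"
        using p_pos by (simp add: F_diff F_of)
      moreover have "Poly_Mapping.lookup (eval_tensor f) k =
          (a + b) mod int p * Poly_Mapping.lookup x k - (a + b) * Poly_Mapping.lookup x k" for k
        by (simp add: right(1) lookup_add lookup_minus algebra_simps)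
      ultimately show ?thesis
        using mod_dvd by simp
    next
      case scalar
      then have "f \<in> carrier F"
        using p_pos by (simp add: F_diff F_of L_cmul)
      moreover have "Poly_Mapping.lookup (eval_tensor f) k =
          - (n * a mod int p * Poly_Mapping.lookup x k - n * a * Poly_Mapping.lookup x k)" for k
        by (simp add: scalar(1) lookup_add lookup_minus algebra_simps)
      ultimately show ?thesis
        using mod_dvd by (simp only: dvd_minus_iff mem_Collect_eq) simp
    qed
  qed
  have "subgroup ?Ker F"
  proof
    show "f \<otimes>\<^bsub>F\<^esub> g \<in> ?Ker" if "f \<in> ?Ker" "g \<in> ?Ker" for f g
      using that F.m_closed [of f g] by (simp add: F_simps lookup_add)
    show "inv\<^bsub>F\<^esub> f \<in> ?Ker" if "f \<in> ?Ker" for f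
      using that F.inv_closed [of f] by (simp add: F_inv)
    show "\<one>\<^bsub>F\<^esub> \<in> ?Ker"
      using F.one_closed by (simp add: F_simps)
  qed auto
  then show "?N \<subseteq> ?Ker"
    by (rule F.generate_subgroup_incl [OF rel])
  have N: "subgroup ?N F"
    using rel by (intro F.generate_is_subgroup) auto
  have N_0: "0 \<in> ?N"
    using subgroup.one_closed [OF N] by (simp add: F_simps)
  have N_add: "f + g \<in> ?N" if "f \<in> ?N" "g \<in> ?N" for f g
    using subgroup.m_closed [OF N that] by (simp add: F_simps)
  have N_minus: "- f \<in> ?N" if "f \<in> ?N" for f
    using subgroup.m_inv_closed [OF N that] subgroup.mem_carrier [OF N that] by (simp add: F_inv)
  have N_diff: "f - g \<in> ?N" if "f \<in> ?N" "g \<in> ?N" for f g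
    using N_add [OF that(1) N_minus [OF that(2)]] by simp
  have R1: "frag_of (x + y, a) - frag_of (x, a) - frag_of (y, a) \<in> ?N"
    if "x \<in> carrier L" "y \<in> carrier L" "0 \<le> a" "a < int p" for x y a
    by (rule generate.incl, unfold tensor_relators_def L(2), rule UnI1, rule UnI1, rule CollectI,
        intro exI [of _ x] exI [of _ y] exI [of _ a]) (use that in simp)
  have R2: "frag_of (x, (a + b) mod int p) - frag_of (x, a) - frag_of (x, b) \<in> ?N"
    if "x \<in> carrier L" "0 \<le> a" "a < int p" "0 \<le> b" "b < int p" for x a b
    by (rule generate.incl, unfold tensor_relators_def, rule UnI1, rule UnI2, rule CollectI,
        intro exI [of _ x] exI [of _ a] exI [of _ b]) (use that in simp)
  have R3: "frag_of (frag_cmul n x, a) - frag_of (x, n * a mod int p) \<in> ?N"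
    if "x \<in> carrier L" "0 \<le> a" "a < int p" for n x a
    by (rule generate.incl, unfold tensor_relators_def L(3), rule UnI2, rule CollectI,
        intro exI [of _ n] exI [of _ x] exI [of _ a]) (use that in \<open>simp add: add_pow_GFp\<close>)
  have normal_form: "f - frag_of (eval_tensor f, 1) \<in> ?N"
    if "Poly_Mapping.keys f \<subseteq> carrier L \<times> carrier (GFp p)" for f
    using that
  proof (induction f rule: free_Abelian_group_induct [consumes 1])
    case 1
    \<comment> \<open>The additivity relator at 0 + 0 is -(0 \<otimes> 1), so 0 \<otimes> 1
      vanishes.\<close>
    have "frag_of (0, 1) - frag_of (0, 1) - frag_of (0, 1) \<in> ?N"
      using R1 [of 0 0 1] L_0 p01 L by simp
    then show ?case by simp
  next
    case (2 f g)
    let ?f = "eval_tensor f" and ?g = "eval_tensor g"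
    have m: "?f \<in> carrier L" "?g \<in> carrier L"
      using 2 keys_eval_tensor [of _ I] unfolding L by blast+
    \<comment> \<open>The induction is over differences, so additivity is applied to the sum of
      \<open>?f - ?g\<close> and \<open>?g\<close>.\<close>
    have "frag_of (?f, 1) - frag_of (?f - ?g, 1) - frag_of (?g, 1) \<in> ?N"
      using R1 [of "?f - ?g" ?g 1] m L_diff p01 by simp
    from N_add [OF N_diff [OF 2(3,4)] this] show ?case
      by (simp add: algebra_simps)
  next
    case (3 z)
    then obtain x a where z: "z = (x, a)" "x \<in> carrier L" "0 \<le> a" "a < int p"
      by auto
    have "frag_of (frag_cmul a x, 1) - frag_of (x, a) \<in> ?N"
      using R3 [of x 1 a] z p01 by simp
    from N_minus [OF this] show ?case
      by (simp add: z)
  qed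
  \<comment> \<open>\<open>p y \<otimes> 1 = y \<otimes> p = 0\<close>\<close>
  show "?Ker \<subseteq> ?N"
  proof
    fix f assume f: "f \<in> ?Ker"
    let ?x = "eval_tensor f"
    define y where "y = Poly_Mapping.map (\<lambda>z. z div int p) ?x"
    have y: "Poly_Mapping.lookup y k = Poly_Mapping.lookup ?x k div int p" for k
      by (simp add: y_def Poly_Mapping.map.rep_eq when_def)
    have xy: "?x = frag_cmul (int p) y"
      by (rule poly_mapping_eqI) (use f in \<open>simp add: y\<close>)
    have "?x \<in> carrier L"
      using f keys_eval_tensor [of f I "{0..<int p}"] by (simp add: L F_def)
    moreover have "Poly_Mapping.keys y \<subseteq> Poly_Mapping.keys ?x"
      by (auto simp: in_keys_iff y)
    ultimately have yL: "y \<in> carrier L"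
      by (auto simp: L)
    have "frag_of (?x, 1) - frag_of (y, 0) \<in> ?N"
      using R3 [OF yL, of 1 "int p"] p01 xy by simp
    \<comment> \<open>Right additivity at 0 + 0 gives y \<otimes> 0 = 0.\<close>
    moreover have "frag_of (y, 0) - frag_of (y, 0) - frag_of (y, 0) \<in> ?N"
      using R2 [OF yL, of 0 0] p01 by simp
    ultimately have "frag_of (?x, 1) \<in> ?N"
      using N_diff by fastforce
    moreover have "f - frag_of (?x, 1) \<in> ?N"
      using f by (intro normal_form) (simp add: F_def)
    ultimately show "f \<in> ?N"
      using N_add by fastforce
  qed
qed

end

section \<open>Coordinates on the reduction of M modulo p\<close>

lemma M_simps:
  "carrier (M c) = {x. Poly_Mapping.keys x \<subseteq> {0..c}}" "add (M c) = (+)" "smult (M c) = frag_cmul"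
  "bracket (M c) x y = frag_extend (\<lambda>i. frag_extend (\<lambda>j.
    if i = 0 \<and> 1 \<le> j \<and> j \<le> c - 1 then frag_of (j + 1)
    else if j = 0 \<and> 1 \<le> i \<and> i \<le> c - 1 then - frag_of (i + 1) else 0) y) x"
  unfolding M_def presented_lie_ring_def basis_bracket_M
  by (simp_all add: free_Abelian_group_def)

text \<open>Both sides are additive in each argument, so comparing them on basis elements is
  enough.\<close>

lemma lookup_bracket_M:
  "Poly_Mapping.lookup (bracket (M c) x y) k =
    (if 2 \<le> k \<and> k \<le> c then Poly_Mapping.lookup x 0 * Poly_Mapping.lookup y (k - 1)
       - Poly_Mapping.lookup y 0 * Poly_Mapping.lookup x (k - 1) else 0)"
    (is "_ = ?rhs x y")
proof -
  define b where "b = (\<lambda>i j :: nat.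
    if i = 0 \<and> 1 \<le> j \<and> j \<le> c - 1 then frag_of (j + 1)
    else if j = 0 \<and> 1 \<le> i \<and> i \<le> c - 1 then - frag_of (i + 1) else 0)"
  have B: "bracket (M c) x y = frag_extend (\<lambda>i. frag_extend (b i) y) x" for x y
    by (simp add: M_simps b_def)
  \<comment> \<open>Otherwise \<open>single_one\<close> rewrites \<open>frag_of 0\<close> to
    \<open>1\<close> and hides the generator x_0.\<close>
  note single_one [simp del]
  have 1: "Poly_Mapping.lookup (b i j) k = ?rhs (frag_of i) (frag_of j)" for i j
    by (auto simp: b_def lookup_single when_def)
  have 2: "Poly_Mapping.lookup (frag_extend (b i) y) k = ?rhs (frag_of i) y" for i y
    by (rule frag_induction [of y UNIV]) (simp_all add: 1 frag_extend_diff lookup_minus algebra_simps)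
  have "Poly_Mapping.lookup (frag_extend (\<lambda>i. frag_extend (b i) y) x) k = ?rhs x y"
    by (rule frag_induction [of x UNIV]) (simp_all add: 2 frag_extend_diff lookup_minus algebra_simps)
  then show ?thesis
    by (simp add: B)
qed

lemma keys_bracket_M: "Poly_Mapping.keys (bracket (M c) x y) \<subseteq> {0..c}"
  by (auto simp: in_keys_iff lookup_bracket_M split: if_splits)

context prime_modulus
begin

text \<open>The basis is reversed: x_0 takes the last position, so the ideal spanned by the other
  generators becomes the hyperplane \<open>vecs c\<close>.\<close>

definition coords :: "nat \<Rightarrow> (nat \<Rightarrow>\<^sub>0 int) \<Rightarrow> nat \<Rightarrow> int" where
  "coords c x = (\<lambda>i. if i \<le> c then Poly_Mapping.lookup x (c - i) mod int p else 0)"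

lemma coords_vecs: "coords c x \<in> vecs (Suc c)"
  using p_pos by (simp add: coords_def vecs_def)

lemma coords_0: "coords c 0 = (\<lambda>_. 0)"
  by (auto simp: coords_def)

lemma coords_add: "coords c (x + y) = lc 1 (coords c x) 1 (coords c y)"
  by (auto simp: coords_def lc_def lookup_add mod_simps)

lemma coords_diff: "coords c (x - y) = lc 1 (coords c x) (- 1) (coords c y)"
  by (auto simp: coords_def lc_def lookup_minus mod_simps)

lemma coords_cmul: "coords c (frag_cmul n x) = lc n (coords c x) 0 (coords c x)"
  by (auto simp: coords_def lc_def mod_simps)

lemma coords_cmul_mod: "coords c (frag_cmul (n mod int p) x) = coords c (frag_cmul n x)"
  by (auto simp: coords_def mod_simps)

lemma coords_bracket: "coords c (bracket (M c) x y) = brac c (coords c x) (coords c y)"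
proof
  fix i
  have k: "c - i - 1 = c - Suc i" by simp
  \<comment> \<open>Position \<open>i\<close> belongs to x_(c-i). For \<open>i + 1 = c\<close> this
    is x_1, which occurs in no bracket, and the products in \<open>brac\<close> cancel; for
    \<open>i \<ge> c\<close> both sides are zero.\<close>
  consider "i + 2 \<le> c" | "i + 1 = c" | "i \<ge> c" by linarith
  then show "coords c (bracket (M c) x y) i = brac c (coords c x) (coords c y) i"
  proof cases
    case 1
    then have "2 \<le> c - i" "c - i \<le> c" "i \<le> c" "Suc i \<le> c" by auto
    then show ?thesis
      by (simp add: coords_def lookup_bracket_M brac_def lc_def shift_def mod_simps mod_lin k)
  qed (auto simp: coords_def lookup_bracket_M brac_def lc_def shift_def mod_simps mult.commute)
qed

lemma coords_eq_0_iff: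
  assumes "Poly_Mapping.keys x \<subseteq> {0..c}"
  shows "coords c x = (\<lambda>_. 0) \<longleftrightarrow> (\<forall>k. int p dvd Poly_Mapping.lookup x k)"
proof
  assume *: "coords c x = (\<lambda>_. 0)"
  show "\<forall>k. int p dvd Poly_Mapping.lookup x k"
  proof
    fix k
    show "int p dvd Poly_Mapping.lookup x k"
    proof (cases "k \<le> c")
      case True
      then show ?thesis
        using fun_cong [OF *, of "c - k"] by (simp add: coords_def dvd_eq_mod_eq_0)
    next
      case False
      then have "k \<notin> Poly_Mapping.keys x"
        using assms by auto
      then show ?thesis
        by (simp add: in_keys_iff)
    qed
  qed
qed (auto simp: coords_def dvd_eq_mod_eq_0)

section \<open>Coordinates of tensors and of their cosets\<close>

definition tcoords :: "nat \<Rightarrow> ((nat \<Rightarrow>\<^sub>0 int) \<times> int \<Rightarrow>\<^sub>0 int) \<Rightarrow> nat \<Rightarrow> int" where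
  "tcoords c f = coords c (eval_tensor f)"

definition tensors :: "nat \<Rightarrow> ((nat \<Rightarrow>\<^sub>0 int) \<times> int \<Rightarrow>\<^sub>0 int) set" where
  "tensors c = {f. Poly_Mapping.keys f \<subseteq> carrier (M c) \<times> carrier (GFp p)}"

text \<open>These turn out to be the cosets that make up the extension of scalars, described without
  the relators.\<close>

definition fibre :: "nat \<Rightarrow> ((nat \<Rightarrow>\<^sub>0 int) \<times> int \<Rightarrow>\<^sub>0 int) \<Rightarrow> ((nat \<Rightarrow>\<^sub>0 int) \<times> int \<Rightarrow>\<^sub>0 int) set" where
  "fibre c f = {g \<in> tensors c. tcoords c g = tcoords c f}"

text \<open>This and \<open>tbracket\<close> are the operations of \<open>extend_scalars\<close> on
  representatives.\<close>

definition tsmult :: "int \<Rightarrow> ((nat \<Rightarrow>\<^sub>0 int) \<times> int \<Rightarrow>\<^sub>0 int) \<Rightarrow> (nat \<Rightarrow>\<^sub>0 int) \<times> int \<Rightarrow>\<^sub>0 int" where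
  "tsmult r f = frag_extend (\<lambda>(x, a). frag_of (x, r \<otimes>\<^bsub>GFp p\<^esub> a)) f"

definition tbracket :: "nat \<Rightarrow> ((nat \<Rightarrow>\<^sub>0 int) \<times> int \<Rightarrow>\<^sub>0 int) \<Rightarrow> ((nat \<Rightarrow>\<^sub>0 int) \<times> int \<Rightarrow>\<^sub>0 int) \<Rightarrow>
    (nat \<Rightarrow>\<^sub>0 int) \<times> int \<Rightarrow>\<^sub>0 int" where
  "tbracket c f g = frag_extend (\<lambda>(x, a). frag_extend (\<lambda>(y, b).
     frag_of (bracket (M c) x y, a \<otimes>\<^bsub>GFp p\<^esub> b)) g) f"

lemma tensors_add: "f \<in> tensors c \<Longrightarrow> g \<in> tensors c \<Longrightarrow> f + g \<in> tensors c"
  and tensors_diff: "f \<in> tensors c \<Longrightarrow> g \<in> tensors c \<Longrightarrow> f - g \<in> tensors c"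
  and tensors_0: "0 \<in> tensors c"
  using keys_add [of f g] keys_diff [of f g] by (auto simp: tensors_def)

lemma tensors_tsmult: "f \<in> tensors c \<Longrightarrow> tsmult r f \<in> tensors c"
  using p_pos unfolding tensors_def tsmult_def mem_Collect_eq
  by (intro order_trans [OF keys_frag_extend]) (auto simp: subset_iff)

lemma tensors_tbracket: "tbracket c f g \<in> tensors c"
proof -
  have of: "Poly_Mapping.keys (frag_of (bracket (M c) x y, a * b mod int p))
      \<subseteq> carrier (M c) \<times> carrier (GFp p)" for x y a b
    using p_pos keys_bracket_M by (simp add: M_simps(1))
  have "Poly_Mapping.keys (frag_extend (\<lambda>(y, b). frag_of (bracket (M c) x y, a * b mod int p)) g)
      \<subseteq> carrier (M c) \<times> carrier (GFp p)" for x a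
    by (rule order_trans [OF keys_frag_extend]) (use of in fast)
  then show ?thesis
    unfolding tensors_def tbracket_def mem_Collect_eq GFp_simps(5)
    by (intro order_trans [OF keys_frag_extend]) fast
qed

lemma tcoords_vecs: "tcoords c f \<in> vecs (Suc c)"
  by (simp add: tcoords_def coords_vecs)

lemma tcoords_mod: "tcoords c f i mod int p = tcoords c f i"
  using tcoords_vecs vecs_mod by blast

lemma tcoords_0: "tcoords c 0 = (\<lambda>_. 0)"
  by (simp add: tcoords_def coords_0)

lemma tcoords_add: "tcoords c (f + g) = lc 1 (tcoords c f) 1 (tcoords c g)"
  and tcoords_diff: "tcoords c (f - g) = lc 1 (tcoords c f) (- 1) (tcoords c g)"
  by (simp_all add: tcoords_def coords_add coords_diff)

lemma tcoords_tsmult: "tcoords c (tsmult r f) = lc r (tcoords c f) 0 (tcoords c f)"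
proof (rule frag_induction [of f UNIV])
  fix z :: "(nat \<Rightarrow>\<^sub>0 int) \<times> int"
  obtain x a where "z = (x, a)" by force
  then show "tcoords c (tsmult r (frag_of z)) = lc r (tcoords c (frag_of z)) 0 (tcoords c (frag_of z))"
    by (simp add: tsmult_def tcoords_def coords_cmul_mod)
      (simp add: coords_cmul lc_def mod_simps mult.assoc)
next
  fix f g
  assume "tcoords c (tsmult r f) = lc r (tcoords c f) 0 (tcoords c f)"
    "tcoords c (tsmult r g) = lc r (tcoords c g) 0 (tcoords c g)"
  then show "tcoords c (tsmult r (f - g)) = lc r (tcoords c (f - g)) 0 (tcoords c (f - g))"
    by (simp add: tsmult_def frag_extend_diff tcoords_diff)
      (simp add: lc_def mod_simps right_diff_distrib)
qed (simp_all add: tsmult_def tcoords_0, simp add: lc_def)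

text \<open>By additivity in both arguments it suffices to treat pure tensors, where the scalars
  pull out of \<open>brac\<close>.\<close>

lemma tcoords_tbracket: "tcoords c (tbracket c f g) = brac c (tcoords c f) (tcoords c g)"
proof -
  have brac_diff: "brac c (lc 1 u (- 1) v) w = lc 1 (brac c u w) (- 1) (brac c v w)"
    "brac c w (lc 1 u (- 1) v) = lc 1 (brac c w u) (- 1) (brac c w v)" for u v w
    by (auto simp: brac_def lc_def shift_def mod_simps mod_lin)
      (simp_all add: mod_simps mod_lin algebra_simps)
  have brac_0: "brac c (\<lambda>_. 0) w = (\<lambda>_. 0)" "brac c w (\<lambda>_. 0) = (\<lambda>_. 0)" for w
    by (simp_all add: brac_def lc_def shift_def)
  have 1: "tcoords c (frag_of (bracket (M c) x y, a * b mod int p)) =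
      brac c (tcoords c (frag_of (x, a))) (tcoords c (frag_of (y, b)))" for x y a b
  proof -
    have "brac c (lc a u 0 u) (lc b v 0 v) = lc (a * b) (brac c u v) 0 (brac c u v)" for u v
      by (auto simp: brac_def lc_def shift_def mod_simps mod_lin)
        (simp_all add: mod_simps mod_lin algebra_simps)
    then show ?thesis
      by (simp add: tcoords_def coords_cmul_mod) (simp add: coords_cmul coords_bracket)
  qed
  have 2: "tcoords c (frag_extend (\<lambda>(y, b). frag_of (bracket (M c) x y, a * b mod int p)) g) =
      brac c (tcoords c (frag_of (x, a))) (tcoords c g)" for x a
    by (rule frag_induction [of g UNIV])
      (auto simp: 1 frag_extend_diff tcoords_diff tcoords_0 brac_0 brac_diff)
  show ?thesis
    unfolding tbracket_def
    by (rule frag_induction [of f UNIV])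
      (auto simp: 2 frag_extend_diff tcoords_diff tcoords_0 brac_0 brac_diff)
qed

lemma tcoords_surj:
  assumes v: "v \<in> vecs (Suc c)"
  obtains f where "f \<in> tensors c" "tcoords c f = v"
proof -
  \<comment> \<open>The integral lift of \<open>v\<close>, in the reversed order of
    \<open>coords\<close>; the required tensor is x \<otimes> 1.\<close>
  define x where "x = (\<Sum>k\<le>c. frag_cmul (v (c - k)) (frag_of k))"
  have x: "Poly_Mapping.lookup x k = (if k \<le> c then v (c - k) else 0)" for k
  proof -
    have "Poly_Mapping.lookup x k = (\<Sum>j\<le>c. if j = k then v (c - j) else 0)"
      unfolding x_def lookup_sum by (intro sum.cong) (auto simp: lookup_single when_def)
    then show ?thesis by simp
  qed
  have "frag_of (x, 1) \<in> tensors c"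
    using p_gt_1 by (auto simp: tensors_def M_simps in_keys_iff x split: if_splits)
  moreover have "tcoords c (frag_of (x, 1)) = v"
    using vecs_mod [OF v] vecs_outside [OF v] by (auto simp: tcoords_def coords_def x)
  ultimately show thesis
    by (rule that)
qed

lemma fibre_eq_iff: "f \<in> tensors c \<Longrightarrow> g \<in> tensors c \<Longrightarrow> fibre c f = fibre c g \<longleftrightarrow> tcoords c f = tcoords c g"
  by (auto simp: fibre_def)

text \<open>The relators generate the kernel of \<open>tcoords\<close>, so cosets are its fibres and
  operations may be computed on any representative.\<close>

lemma extend_scalars_M:
  fixes c :: nat
  defines "V \<equiv> extend_scalars (M c) (GFp p)"
  shows "carrier V = fibre c ` tensors c"
    and "\<zero>\<^bsub>V\<^esub> = fibre c 0"
    and "\<lbrakk>f \<in> tensors c; g \<in> tensors c\<rbrakk> \<Longrightarrow> fibre c f \<oplus>\<^bsub>V\<^esub> fibre c g = fibre c (f + g)"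
    and "f \<in> tensors c \<Longrightarrow> r \<odot>\<^bsub>V\<^esub> fibre c f = fibre c (tsmult r f)"
    and "\<lbrakk>f \<in> tensors c; g \<in> tensors c\<rbrakk> \<Longrightarrow>
      bracket V (fibre c f) (fibre c g) = fibre c (tbracket c f g)"
proof -
  define F where "F = free_Abelian_group (carrier (M c) \<times> carrier (GFp p))"
  define N where "N = generate F (tensor_relators (M c) (GFp p))"
  have V: "V = \<lparr>carrier = carrier (F Mod N), monoid.mult = undefined, one = undefined,
      zero = \<one>\<^bsub>F Mod N\<^esub>, add = (\<lambda>X Y. X \<otimes>\<^bsub>F Mod N\<^esub> Y),
      smult = (\<lambda>r X. \<Union>f\<in>X. N #>\<^bsub>F\<^esub> tsmult r f),
      bracket = (\<lambda>X Y. \<Union>f\<in>X. \<Union>g\<in>Y. N #>\<^bsub>F\<^esub> tbracket c f g)\<rparr>"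
    by (simp add: V_def extend_scalars_def Let_def F_def N_def tsmult_def tbracket_def)
  have F: "carrier F = tensors c" "\<one>\<^bsub>F\<^esub> = 0" "f \<otimes>\<^bsub>F\<^esub> g = f + g" for f g
    by (simp_all add: F_def tensors_def set_eq_iff)
  interpret F: comm_group F
    by (simp add: F_def abelian_free_Abelian_group)
  have N: "N = {f \<in> tensors c. tcoords c f = (\<lambda>_. 0)}"
  proof -
    have "N = {f \<in> tensors c. \<forall>k. int p dvd Poly_Mapping.lookup (eval_tensor f) k}"
      using generate_tensor_relators [OF M_simps(1-3)] unfolding N_def F(1) [symmetric] F_def .
    moreover have "Poly_Mapping.keys (eval_tensor f) \<subseteq> {0..c}" if "f \<in> tensors c" for f
      using that unfolding tensors_def M_simps(1) mem_Collect_eq by (rule keys_eval_tensor)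
    ultimately show ?thesis
      using coords_eq_0_iff by (auto simp: tcoords_def)
  qed
  have rel: "tensor_relators (M c) (GFp p) \<subseteq> carrier F"
    using generate.incl [of _ "tensor_relators (M c) (GFp p)" F] N N_def F(1) by auto
  have sub: "subgroup N F"
    unfolding N_def by (rule F.generate_is_subgroup [OF rel])
  interpret N: normal N F
    by (rule F.subgroup_imp_normal [OF sub])
  have coset: "N #>\<^bsub>F\<^esub> f = fibre c f" if f: "f \<in> tensors c" for f
  proof (intro equalityI subsetI)
    fix g assume "g \<in> N #>\<^bsub>F\<^esub> f"
    then obtain h where h: "h \<in> N" "g = h + f"
      by (auto simp: r_coset_def F)
    then have "tcoords c g = tcoords c f"
      by (simp add: N tcoords_add) (simp add: lc_def tcoords_mod)
    then show "g \<in> fibre c f"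
      using h f by (simp add: fibre_def N tensors_add)
  next
    fix g assume g: "g \<in> fibre c f"
    then have "tcoords c (g - f) = (\<lambda>_. 0)"
      by (simp add: fibre_def tcoords_diff) (simp add: lc_def)
    then have "g - f \<in> N"
      using g f by (simp add: N fibre_def tensors_diff)
    then show "g \<in> N #>\<^bsub>F\<^esub> f"
      unfolding r_coset_def F by (intro UN_I [of "g - f"]) auto
  qed
  show "carrier V = fibre c ` tensors c"
    using coset by (auto simp: V FactGroup_def RCOSETS_def F)
  show "\<zero>\<^bsub>V\<^esub> = fibre c 0"
    using coset [OF tensors_0] F.coset_mult_one [of N] N.subset by (simp add: V FactGroup_def F)
  show "fibre c f \<oplus>\<^bsub>V\<^esub> fibre c g = fibre c (f + g)" if "f \<in> tensors c" "g \<in> tensors c"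
    using N.rcos_sum [of f g] that coset tensors_add by (simp add: V FactGroup_def F)
  have self: "f \<in> fibre c f" if "f \<in> tensors c" for f
    using that by (simp add: fibre_def)
  show "r \<odot>\<^bsub>V\<^esub> fibre c f = fibre c (tsmult r f)" if f: "f \<in> tensors c"
  proof -
    \<comment> \<open>The result is independent of the representative, so the union in
      \<open>extend_scalars\<close> runs over copies of one coset; \<open>self\<close> makes it
      nonempty.\<close>
    have "N #>\<^bsub>F\<^esub> tsmult r g = fibre c (tsmult r f)" if "g \<in> fibre c f" for g
      using that f by (simp add: coset tensors_tsmult fibre_eq_iff tcoords_tsmult fibre_def)
    then show ?thesis
      using self [OF f] by (auto simp: V)
  qed
  show "bracket V (fibre c f) (fibre c g) = fibre c (tbracket c f g)"
    if f: "f \<in> tensors c" and g: "g \<in> tensors c"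
  proof -
    have "N #>\<^bsub>F\<^esub> tbracket c f' g' = fibre c (tbracket c f g)"
      if "f' \<in> fibre c f" "g' \<in> fibre c g" for f' g'
      using that by (simp add: coset tensors_tbracket fibre_eq_iff tcoords_tbracket fibre_def)
    then show ?thesis
      using self [OF f] self [OF g] by (auto simp: V)
  qed
qed

text \<open>All members of a fibre share their coordinates, so the choice does not matter
  there.\<close>

definition coset_coords :: "nat \<Rightarrow> ((nat \<Rightarrow>\<^sub>0 int) \<times> int \<Rightarrow>\<^sub>0 int) set \<Rightarrow> nat \<Rightarrow> int" where
  "coset_coords c X = tcoords c (SOME f. f \<in> X)"

lemma coset_coords_fibre: "f \<in> tensors c \<Longrightarrow> coset_coords c (fibre c f) = tcoords c f"
  unfolding coset_coords_def
  by (rule someI2 [of _ f]) (auto simp: fibre_def)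

lemma coordinates_M: "coordinates p (extend_scalars (M c) (GFp p)) (coset_coords c) (Suc c)"
proof unfold_locales
  let ?V = "extend_scalars (M c) (GFp p)"
  show "bij_betw (coset_coords c) (carrier ?V) (vecs (Suc c))"
    unfolding bij_betw_def
  proof
    show "inj_on (coset_coords c) (carrier ?V)"
      by (auto simp: inj_on_def extend_scalars_M coset_coords_fibre fibre_eq_iff)
    show "coset_coords c ` carrier ?V = vecs (Suc c)"
    proof (intro equalityI subsetI)
      fix v assume "v \<in> vecs (Suc c)"
      then obtain f where "f \<in> tensors c" "tcoords c f = v"
        by (rule tcoords_surj)
      then show "v \<in> coset_coords c ` carrier ?V"
        by (auto simp: extend_scalars_M coset_coords_fibre intro!: image_eqI)
    qed (auto simp: extend_scalars_M coset_coords_fibre tcoords_vecs)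
  qed
qed (auto simp: extend_scalars_M coset_coords_fibre tensors_0 tensors_add tensors_tsmult
    tcoords_0 tcoords_add tcoords_tsmult)

lemma lie_subalgebra_iff:
  assumes H: "VectorSpace.subspace (GFp p) H (extend_scalars (M c) (GFp p))"
  shows "(\<forall>X\<in>H. \<forall>Y\<in>H. bracket (extend_scalars (M c) (GFp p)) X Y \<in> H) \<longleftrightarrow>
    (\<forall>f\<in>coset_coords c ` H. \<forall>g\<in>coset_coords c ` H. brac c f g \<in> coset_coords c ` H)"
proof -
  let ?V = "extend_scalars (M c) (GFp p)"
  interpret coordinates p ?V "coset_coords c" "Suc c"
    by (rule coordinates_M)
  have H: "H \<subseteq> carrier ?V"
    using H by (simp add: subspace_def submodule_def)
  have "bracket ?V X Y \<in> H \<longleftrightarrow> brac c (coset_coords c X) (coset_coords c Y) \<in> coset_coords c ` H"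
    if "X \<in> H" "Y \<in> H" for X Y
  proof -
    have "X \<in> fibre c ` tensors c" "Y \<in> fibre c ` tensors c"
      using that H extend_scalars_M(1) by blast+
    then obtain f g where fg: "f \<in> tensors c" "X = fibre c f" "g \<in> tensors c" "Y = fibre c g"
      by blast
    have "bracket ?V X Y \<in> carrier ?V"
      using fg tensors_tbracket by (simp add: extend_scalars_M)
    moreover have "coset_coords c (bracket ?V X Y) = brac c (coset_coords c X) (coset_coords c Y)"
      using fg tensors_tbracket by (simp add: extend_scalars_M coset_coords_fibre tcoords_tbracket)
    moreover have "inj_on (coset_coords c) (carrier ?V)"
      using bij by (simp add: bij_betw_def)
    ultimately show ?thesis
      using inj_on_image_mem_iff H by metis
  qed
  then show ?thesis
    by auto
qed

section \<open>The zeta function in closed form and its recursion\<close>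

lemma num_subalgebras_M:
  assumes "i \<le> Suc c"
  shows "num_subalgebras p (M c) i = card (subalgs c (Suc c - i))"
proof -
  let ?V = "extend_scalars (M c) (GFp p)"
  interpret coordinates p ?V "coset_coords c" "Suc c"
    by (rule coordinates_M)
  \<comment> \<open>The total dimension is \<open>Suc c\<close> and \<open>i\<close> does not exceed
    it, so the truncated subtraction is exact.\<close>
  have "d + i = vectorspace.dim (GFp p) ?V \<longleftrightarrow> d = Suc c - i" for d
    using assms dim_V by auto
  then have "num_subalgebras p (M c) i = card {H. VectorSpace.subspace (GFp p) H ?V \<and>
      (\<forall>X\<in>H. \<forall>Y\<in>H. bracket ?V X Y \<in> H) \<and>
      vectorspace.dim (GFp p) (?V\<lparr>carrier := H\<rparr>) = Suc c - i}"
    by (simp add: num_subalgebras_def lie_subalgebra_def Let_def)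
  also have "\<dots> = card (subalgs c (Suc c - i))"
    unfolding subalgs_def by (rule card_subspaces_transport) (rule lie_subalgebra_iff)
  finally show ?thesis .
qed

lemma subalgebra_zeta_M:
  fixes s :: complex
  defines "t \<equiv> (of_nat p :: complex) powr (- s)"
  shows "subalgebra_zeta p (M c) s =
    (\<Sum>i\<le>c. of_nat (gauss c i) * t ^ Suc i) + (\<Sum>i\<le>c. of_nat p ^ i * t ^ i)"
proof -
  have num: "num_subalgebras p (M c) i = gauss c (Suc c - i) + p ^ i" if "i \<le> c" for i
    using card_subalgs_Suc [of "c - i" c] num_subalgebras_M [of i c] that by (simp add: Suc_diff_le)
  have "subalgebra_zeta p (M c) s = (\<Sum>i\<le>Suc c. of_nat (num_subalgebras p (M c) i) * t ^ i)"
    by (simp add: subalgebra_zeta_def t_def lie_ring_rank_M atMost_atLeast0)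
  also have "\<dots> = (\<Sum>i\<le>c. of_nat (gauss c (Suc c - i) + p ^ i) * t ^ i) + t ^ Suc c"
    using num_subalgebras_M [of "Suc c" c] by (simp add: num card_subalgs_0)
  \<comment> \<open>The term of the zero subalgebra, in codimension \<open>Suc c\<close>, is
    absorbed as \<open>gauss c 0 = 1\<close>.\<close>
  also have "\<dots> = (\<Sum>i\<le>Suc c. of_nat (gauss c (Suc c - i)) * t ^ i) + (\<Sum>i\<le>c. of_nat p ^ i * t ^ i)"
    by (simp add: gauss_0 distrib_right sum.distrib)
  also have "(\<Sum>i\<le>Suc c. of_nat (gauss c (Suc c - i)) * t ^ i) =
      (\<Sum>i\<le>c. of_nat (gauss c i) * t ^ Suc i)"
    \<comment> \<open>The term \<open>i = 0\<close> is \<open>gauss c (Suc c) = 0\<close>; the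
      others are reindexed by one and reflected by symmetry.\<close>
    by (subst sum.atMost_Suc_shift) (simp add: gauss_eq_0 gauss_symmetric [symmetric])
  finally show ?thesis .
qed

text \<open>The q-Pascal rule splits the first sum of the closed form into that of
  \<open>M m\<close> and the sum over \<open>a\<close>; the second sum gains its last term.\<close>

lemma subalgebra_zeta_M_Suc:
  fixes s :: complex
  defines "t \<equiv> (of_nat p :: complex) powr (- s)"
  shows "subalgebra_zeta p (M (Suc m)) s = subalgebra_zeta p (M m) s
    + (\<Sum>a\<le>m. of_nat (gauss m a) * of_nat p ^ (m - a) * t ^ (a + 2)) + of_nat p ^ Suc m * t ^ Suc m"
proof -
  have "(\<Sum>i\<le>Suc m. of_nat (gauss (Suc m) i) * t ^ Suc i) =
      t + (\<Sum>a\<le>m. of_nat (gauss (Suc m) (Suc a)) * t ^ (a + 2))"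
    by (subst sum.atMost_Suc_shift) (simp add: gauss_0)
  also have "(\<Sum>a\<le>m. of_nat (gauss (Suc m) (Suc a)) * t ^ (a + 2)) =
      (\<Sum>a\<le>m. of_nat (gauss m (Suc a)) * t ^ (a + 2))
      + (\<Sum>a\<le>m. of_nat (gauss m a) * of_nat p ^ (m - a) * t ^ (a + 2))"
    unfolding sum.distrib [symmetric]
    by (intro sum.cong refl) (simp add: gauss_Suc algebra_simps)
  \<comment> \<open>The lone \<open>t\<close> is the term \<open>i = 0\<close>.\<close>
  also have "t + \<dots> = (\<Sum>i\<le>Suc m. of_nat (gauss m i) * t ^ Suc i)
      + (\<Sum>a\<le>m. of_nat (gauss m a) * of_nat p ^ (m - a) * t ^ (a + 2))"
    by (subst sum.atMost_Suc_shift) (simp add: gauss_0)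
  also have "(\<Sum>i\<le>Suc m. of_nat (gauss m i) * t ^ Suc i) = (\<Sum>i\<le>m. of_nat (gauss m i) * t ^ Suc i)"
    by (simp add: gauss_eq_0)
  finally show ?thesis
    by (simp add: subalgebra_zeta_M t_def [symmetric])
qed

end

theorem theorem3p5:
  fixes p :: nat and s :: complex
  assumes "prime p"
  shows "let t = (of_nat p :: complex) powr (- s) in
    subalgebra_zeta p (M 2) s =
      1 + (1 + of_nat p) * t + (1 + of_nat p + of_nat p ^ 2) * t ^ 2 + t ^ 3 \<and>
    (\<forall>c\<ge>3. subalgebra_zeta p (M c) s =
      subalgebra_zeta p (M (c - 1)) s +
      (\<Sum>a = 0..c - 1. of_nat (gauss_binomial p (c - 1) a) * of_nat p ^ (c - 1 - a) * t ^ (a + 2)) +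
      of_nat p ^ c * t ^ c)"
proof -
  interpret prime_modulus p
    by unfold_locales (rule assms)
  define t where "t = (of_nat p :: complex) powr (- s)"
  \<comment> \<open>The only Gaussian binomial different from 1 in the closed form for
    \<open>M 2\<close>.\<close>
  have "gauss 2 1 = Suc p"
    using gauss_Suc [of 0 1] gauss_self [of 1] by (simp add: gauss_0 numeral_2_eq_2)
  then have "subalgebra_zeta p (M 2) s =
      1 + (1 + of_nat p) * t + (1 + of_nat p + of_nat p ^ 2) * t ^ 2 + t ^ 3"
    using gauss_self [of 2]
    by (simp add: subalgebra_zeta_M t_def [symmetric] numeral_2_eq_2 numeral_3_eq_3 gauss_0 algebra_simps)
  moreover have "subalgebra_zeta p (M c) s = subalgebra_zeta p (M (c - 1)) s +
      (\<Sum>a = 0..c - 1. of_nat (gauss_binomial p (c - 1) a) * of_nat p ^ (c - 1 - a) * t ^ (a + 2)) +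
      of_nat p ^ c * t ^ c" if "c \<ge> 3" for c
    using subalgebra_zeta_M_Suc [of "c - 1" s] that
    by (simp add: t_def gauss_binomial_eq atMost_atLeast0)
  ultimately show ?thesis
    by (simp add: Let_def t_def)
qed

end
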